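(* Let $E$ be an entire function in the Hermite-Biehler class $\mathcal{H}B$ such that the de Branges space $H(E)$ is regular. Let $\phi(z)=az+b$, where $0<a\le 1$ and $b=b_1+ib_2$ with $b_1\in\mathbb{R}$, $b_2\ge 0$. If $\frac{E(az+b)}{E(z)}\in L^\infty(\mathbb{R})$ (i.e. the function $t\mapsto\frac{E(at+b)}{E(t)}$ is essentially bounded on the real line), then the composition operator $C_\phi$, $C_\phi f=f\circ\phi$, is bounded on $H(E)$.
   Context: $\mathbb{C}_+$ is the open upper half-plane; for an entire function $f$, $f^{\#}(z):=\overline{f(\bar z)}$. $H^2(\mathbb{C}_+)$ is the Hardy Hilbert space on $\mathbb{C}_+$. An entire function $E$ is in the Hermite-Biehler class $\mathcal{H}B$ if $|E(\bar z)|<|E(z)|$ for all $z\in\mathbb{C}_+$. For $E\in\mathcal{H}B$ the de Branges space is $$H(E):=\left\{f \text{ entire}: \tfrac{f}{E},\ \tfrac{f^{\#}}{E}\in H^2(\mathbb{C}_+)\right\},\qquad \langle f,g\rangle_{H(E)}=\int_{-\infty}^{\infty}\frac{f(t)\overline{g(t)}}{|E(t)|^2}\,dt .$$ For $\alpha\in\mathbb{C}$ the generalized backward shift $R_\alpha$ is defined on entire functions by $(R_\alpha g)(\xi)=\frac{g(\xi)-g(\alpha)}{\xi-\alpha}$ for $\xi\neq\alpha$ and $(R_\alpha g)(\alpha)=g'(\alpha)$. The space $H(E)$ is called regular if $R_\alpha H(E)\subseteq H(E)$ for every $\alpha\in\mathbb{C}$. Saying that $C_\phi$ is bounded on $H(E)$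 means that $f\circ\phi\in H(E)$ for every $f\in H(E)$ and $f\mapsto f\circ\phi$ is a bounded linear operator on $H(E)$. *)

theory Defs
  imports "HOL-Complex_Analysis.Complex_Analysis"
begin

definition upper_half_plane :: "complex set" where
  "upper_half_plane = {z. Im z > 0}"

definition sharp :: "(complex \<Rightarrow> complex) \<Rightarrow> complex \<Rightarrow> complex" where
  "sharp f = (\<lambda>z. cnj (f (cnj z)))"

text \<open>Elements are total functions, but only their values on the open upper half-plane matter.\<close>

definition hardy_H2 :: "(complex \<Rightarrow> complex) set" where
  "hardy_H2 = {F. F holomorphic_on upper_half_plane \<and>
     (SUP y\<in>{0<..}. \<integral>\<^sup>+ x. ennreal ((cmod (F (Complex x y)))\<^sup>2) \<partial>lborel) < \<infinity>}"

definition hermite_biehler :: "(complex \<Rightarrow> complex) \<Rightarrow> bool" where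
  "hermite_biehler E \<longleftrightarrow> E holomorphic_on UNIV \<and>
     (\<forall>z\<in>upper_half_plane. cmod (E (cnj z)) < cmod (E z))"

definition de_Branges :: "(complex \<Rightarrow> complex) \<Rightarrow> (complex \<Rightarrow> complex) set" where
  "de_Branges E = {f. f holomorphic_on UNIV \<and>
     (\<lambda>z. f z / E z) \<in> hardy_H2 \<and> (\<lambda>z. sharp f z / E z) \<in> hardy_H2}"

text \<open>For \<open>f\<close> and \<open>g\<close> in the space, the integrand is Lebesgue integrable, being a product of
  boundary functions of Hardy space elements; so the convention that the Bochner integral of a
  non-integrable function is \<open>0\<close> plays no role.\<close>

definition dB_inner ::
  "(complex \<Rightarrow> complex) \<Rightarrow> (complex \<Rightarrow> complex) \<Rightarrow> (complex \<Rightarrow> complex) \<Rightarrow> complex" where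
  "dB_inner E f g =
     (LINT t|lborel. f (of_real t) * cnj (g (of_real t)) / of_real ((cmod (E (of_real t)))\<^sup>2))"

definition dB_norm :: "(complex \<Rightarrow> complex) \<Rightarrow> (complex \<Rightarrow> complex) \<Rightarrow> real" where
  "dB_norm E f = sqrt (Re (dB_inner E f f))"

definition backward_shift :: "complex \<Rightarrow> (complex \<Rightarrow> complex) \<Rightarrow> complex \<Rightarrow> complex" where
  "backward_shift \<alpha> g = (\<lambda>\<xi>. if \<xi> = \<alpha> then deriv g \<alpha> else (g \<xi> - g \<alpha>) / (\<xi> - \<alpha>))"

definition regular_dB :: "(complex \<Rightarrow> complex) \<Rightarrow> bool" where
  "regular_dB E \<longleftrightarrow> (\<forall>\<alpha>. backward_shift \<alpha> ` de_Branges E \<subseteq> de_Branges E)"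

definition ess_bounded :: "(real \<Rightarrow> complex) \<Rightarrow> bool" where
  "ess_bounded h \<longleftrightarrow> h \<in> borel_measurable lborel \<and> (\<exists>M. AE t in lborel. cmod (h t) \<le> M)"

definition comp_op ::
  "(complex \<Rightarrow> complex) \<Rightarrow> (complex \<Rightarrow> complex) \<Rightarrow> complex \<Rightarrow> complex" where
  "comp_op \<phi> f = f \<circ> \<phi>"

definition bounded_operator_dB ::
  "(complex \<Rightarrow> complex) \<Rightarrow> ((complex \<Rightarrow> complex) \<Rightarrow> complex \<Rightarrow> complex) \<Rightarrow> bool" where
  "bounded_operator_dB E T \<longleftrightarrow>
     (\<forall>f\<in>de_Branges E. T f \<in> de_Branges E) \<and>
     (\<forall>f\<in>de_Branges E. \<forall>g\<in>de_Branges E. T (\<lambda>z. f z + g z) = (\<lambda>z. T f z + T g z)) \<and>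
     (\<forall>c. \<forall>f\<in>de_Branges E. T (\<lambda>z. c * f z) = (\<lambda>z. c * T f z)) \<and>
     (\<exists>C. \<forall>f\<in>de_Branges E. dB_norm E (T f) \<le> C * dB_norm E f)"

end

theory Submission
  imports Defs "HOL-Real_Asymp.Real_Asymp"
begin

text \<open>
  For a bounded composition operator two things are needed: the norm estimate and the membership
  of \<open>f(a z + b)\<close> in \<open>H(E)\<close>. On the real line
  \<open>f(a t + b) / E(t)\<close> is the product of \<open>f / E\<close> at \<open>a t + b\<close> and of
  \<open>E(a t + b) / E(t)\<close>. The second factor is bounded by \<open>M\<close>, and the mean square of a
  Hardy function on a horizontal line is at most its mean square on the real line; hence
  \<open>f(a z + b)\<close> has norm at most \<open>M / sqrt a\<close> times the norm of \<open>f\<close>.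

  Membership asks for the same square mean on all lines above the real one, for the two functions
  \<open>k(a z + \<beta>) / E(z)\<close> in which \<open>(k, \<beta>)\<close> is \<open>(f, b)\<close> or
  \<open>(f\<^sup>#, cnj b)\<close>; on the real line they have equal modulus. In both cases, and
  also for \<open>f / E\<close> itself, the passage from the real line to the half-plane is a
  Phragmen-Lindelof principle in the square mean (\<open>L2_Phragmen_Lindelof\<close>). It allows growth
  \<open>exp (C |z|^2)\<close> near the real axis, provided that the growth in a cone around the
  imaginary axis is slower than every exponential.

  These growth conditions come from regularity. Subtracting a backward shift of a nonzero
  \<open>f\<close> from \<open>f / (z - \<alpha>)\<close> shows that \<open>1 / ((z - \<alpha>) E)\<close> is a Hardy function
  for some \<open>\<alpha>\<close> in the lower half-plane (\<open>regular_imp_reciprocal_hardy\<close>). A Hardy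
  function is at most of order \<open>1 / sqrt y\<close> at height \<open>y\<close>
  (\<open>hardy_pointwise_bound\<close>), so that \<open>E\<close> is bounded from below: it has no real zeros, and \<open>log |E|\<close> is, up to
  logarithmic terms, a positive harmonic function. Harnack's inequality then does two things.
  It bounds \<open>log |E|\<close> from above by a power of \<open>|z|\<close> and of the distance to the real
  axis; entire functions cannot exploit the singularity of such a bound
  (\<open>entire_bound_across_real_axis\<close>), which yields the growth \<open>exp (C |z|^2)\<close> for
  \<open>f\<close> and \<open>f\<^sup>#\<close>. And it shows that \<open>log |E(z)|\<close> behaves like
  \<open>c Im z\<close> with some \<open>c \<ge> 0\<close> in cones, so that, because of \<open>a \<le> 1\<close>, the quotient
  \<open>E(a z + \<beta>) / E(z)\<close> grows there more slowly than every exponential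
  (\<open>E_ratio_bound\<close>).

  If \<open>H(E)\<close> contains only the zero function, there is nothing to prove.
\<close>

section \<open>Phragmen-Lindelof principles for the upper half-plane\<close>

lemma frontier_subset_diff:
  fixes S :: "'a::topological_space set"
  assumes "closed S" "open U" "U \<subseteq> S"
  shows "frontier S \<subseteq> S - U"
proof -
  have "U \<subseteq> interior S" using assms by (simp add: interior_maximal)
  then show ?thesis using assms(1) by (auto simp: frontier_def)
qed

text \<open>
  A form of the maximum principle that avoids computing the frontier of \<open>S\<close>: it suffices
  that \<open>U\<close> and \<open>V\<close> enclose the interior of \<open>S\<close> from inside and outside. In the
  applications \<open>S\<close> is given by weak inequalities and \<open>U\<close> by the strict ones.
\<close>

lemma maximum_modulus_compact:
  fixes f :: "complex \<Rightarrow> complex"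
  assumes "compact S" "open U" "U \<subseteq> S" "open V" "interior S \<subseteq> V" "f holomorphic_on V"
    and "continuous_on S f"
    and "\<And>z. z \<in> S - U \<Longrightarrow> cmod (f z) \<le> B" and "z \<in> S"
  shows "cmod (f z) \<le> B"
proof (rule maximum_modulus_frontier[where S = S and f = f])
  have cl: "closed S" using assms(1) by (rule compact_imp_closed)
  show "f holomorphic_on interior S" using holomorphic_on_subset[OF assms(6,5)] .
  show "continuous_on (closure S) f" using assms(7) cl by simp
  show "bounded S" using assms(1) by (rule compact_imp_bounded)
  show "cmod (f z) \<le> B" if "z \<in> frontier S" for z
    using frontier_subset_diff[OF cl assms(2,3)] that assms(8) by blast
qed (use assms in auto)

lemma Re_power3: "Re (z ^ 3) = Re z * ((Re z)\<^sup>2 - 3 * (Im z)\<^sup>2)"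
  by (simp add: power3_eq_cube power2_eq_square algebra_simps)

lemma Re_power3_ge:
  assumes "\<bar>Im z\<bar> \<le> Re z / 3"
  shows "(Re z) ^ 3 / 2 \<le> Re (z ^ 3)"
proof -
  have p: "0 \<le> Re z" using assms by linarith
  have "(Im z)\<^sup>2 \<le> (Re z / 3)\<^sup>2"
    using assms p by (simp add: abs_le_square_iff[symmetric])
  then have "(Re z)\<^sup>2 / 2 \<le> (Re z)\<^sup>2 - 3 * (Im z)\<^sup>2"
    using zero_le_power2[of "Re z"] unfolding power_divide by (simp add: power_divide; linarith)
  then have "Re z * ((Re z)\<^sup>2 / 2) \<le> Re z * ((Re z)\<^sup>2 - 3 * (Im z)\<^sup>2)"
    by (rule mult_left_mono[OF _ p])
  then show ?thesis
    by (simp only: Re_power3) (simp add: power3_eq_cube power2_eq_square)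
qed

text \<open>
  The sector has an opening of less than \<open>\<pi> / 3\<close>, so the real part of \<open>z ^ 3\<close> is
  comparable with \<open>|z| ^ 3\<close> on it. Multiplication by \<open>exp (- k z^3)\<close> with a small
  \<open>k > 0\<close> therefore beats the quadratic exponent, and the maximum principle applies on
  large truncated sectors. A cubic multiplier needs no branch of a fractional power.
\<close>

lemma Phragmen_Lindelof_sector:
  fixes f :: "complex \<Rightarrow> complex"
  defines "S \<equiv> {z. \<bar>Im z\<bar> \<le> Re z / 3}" and "S0 \<equiv> {z. \<bar>Im z\<bar> < Re z / 3}"
  assumes C: "0 \<le> C" and cont: "continuous_on S f" and hol: "f holomorphic_on S0"
    and growth: "\<And>z. z \<in> S \<Longrightarrow> cmod (f z) \<le> exp (C * (1 + cmod z)\<^sup>2)"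
    and bdry: "\<And>z. \<bar>Im z\<bar> = Re z / 3 \<Longrightarrow> cmod (f z) \<le> B"
    and "z \<in> S"
  shows "cmod (f z) \<le> B"
proof -
  have B0: "0 \<le> B" using bdry[of 0] norm_ge_zero[of "f 0"] by (simp; linarith)
  have damp: "cmod (f z * exp (- of_real k * z ^ 3)) \<le> B" if k: "k > 0" for k
  proof -
    define g where "g = (\<lambda>w. f w * exp (- of_real k * w ^ 3))"
    have cmg: "cmod (g w) = cmod (f w) * exp (- k * Re (w ^ 3))" for w
      by (simp add: g_def norm_mult)
    have "eventually (\<lambda>R::real. exp (C * (1 + (4/3) * R)\<^sup>2 - k * (R ^ 3 / 2)) \<le> B + e) at_top"
      if "e > 0" for e
    proof -
      have "((\<lambda>R::real. exp (C * (1 + (4/3) * R)\<^sup>2 - k * (R ^ 3 / 2))) \<longlongrightarrow> 0) at_top"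
        using k C by (cases "C = 0"; real_asymp)
      then have "eventually (\<lambda>R::real. exp (C * (1 + (4/3) * R)\<^sup>2 - k * (R ^ 3 / 2)) < B + e) at_top"
        by (rule order_tendstoD) (use that B0 in auto)
      then show ?thesis by (rule eventually_mono) auto
    qed note ev = this
    have *: "cmod (g z) \<le> B + e" if e: "e > 0" for e
    proof -
      have "eventually (\<lambda>R::real. R > max 0 (Re z)) at_top" by (rule eventually_gt_at_top)
      with ev[OF e] obtain R where R: "R > 0" "Re z < R"
        "exp (C * (1 + (4/3) * R)\<^sup>2 - k * (R ^ 3 / 2)) \<le> B + e"
        by (metis (mono_tags, lifting) eventually_conj eventually_happens' max_less_iff_conj trivial_limit_at_top_linorder)
      define T where "T = {w. \<bar>Im w\<bar> \<le> Re w / 3 \<and> Re w \<le> R}"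
      define T0 where "T0 = {w. \<bar>Im w\<bar> < Re w / 3 \<and> Re w < R}"
      have clT: "closed T" unfolding T_def
        by (intro closed_Collect_conj closed_Collect_le continuous_intros) auto
      have opT: "open T0" unfolding T0_def
        by (intro open_Collect_conj open_Collect_less continuous_intros) auto
      have opS0: "open S0" unfolding S0_def
        by (intro open_Collect_less continuous_intros) auto
      have cT: "cmod w \<le> (4/3) * R" if "w \<in> T" for w
        using that cmod_le[of w] unfolding T_def by auto
      show ?thesis
      proof (rule maximum_modulus_compact[where S = T and U = T0 and V = S0 and f = g])
        show "compact T" using clT cT by (meson boundedI compact_eq_bounded_closed)
        show "T0 \<subseteq> T" by (auto simp: T_def T0_def)
        \<comment> \<open>A point of the boundary rays leaves the sector when moved to the left.\<close>
        have "interior T \<subseteq> S0"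
        proof
          fix w assume w: "w \<in> interior T"
          then obtain d where d: "d > 0" "ball w d \<subseteq> T" by (meson mem_interior)
          have wT: "w \<in> T" using w interior_subset by blast
          have "w - of_real (d/2) \<in> T" 
            by (rule subsetD[OF d(2)]) (use d(1) in \<open>simp add: dist_norm\<close>)
          then show "w \<in> S0" using d(1) unfolding T_def S0_def by auto
        qed
        then show "interior T \<subseteq> S0" .
        show "g holomorphic_on S0" unfolding g_def by (intro holomorphic_intros hol)
        have "continuous_on T f" by (rule continuous_on_subset[OF cont]) (auto simp: T_def S_def)
        then show "continuous_on T g" unfolding g_def by (intro continuous_intros)
        show "z \<in> T" using R \<open>z \<in> S\<close> by (auto simp: S_def T_def)
        show "cmod (g w) \<le> B + e" if w: "w \<in> T - T0" for w
        proof -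
          have wS: "w \<in> S" using w by (auto simp: T_def S_def)
          have Re3: "(Re w) ^ 3 / 2 \<le> Re (w ^ 3)" using wS by (intro Re_power3_ge) (simp add: S_def)
          have "Re w \<ge> 0" using wS by (auto simp: S_def)
          then have Re3': "0 \<le> Re (w ^ 3)" using Re3 by (smt (verit) zero_le_power divide_nonneg_pos)
          consider "\<bar>Im w\<bar> = Re w / 3" | "Re w = R" using w by (force simp: T_def T0_def)
          then show ?thesis
          proof cases
            case 1
            have "cmod (g w) \<le> cmod (f w) * 1" unfolding cmg
              by (rule mult_left_mono) (use k Re3' in auto)
            then show ?thesis using bdry[OF 1] e by linarith
          next
            case 2
            have "cmod (g w) \<le> exp (C * (1 + cmod w)\<^sup>2) * exp (- k * Re (w ^ 3))"
              unfolding cmg by (intro mult_right_mono growth wS) auto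
            also have "\<dots> \<le> exp (C * (1 + (4/3) * R)\<^sup>2) * exp (- k * (R ^ 3 / 2))"
              using k C Re3 2 cT[of w] w by (intro mult_mono) (auto intro!: mult_left_mono power_mono)
            also have "\<dots> = exp (C * (1 + (4/3) * R)\<^sup>2 - k * (R ^ 3 / 2))"
              by (simp add: exp_add[symmetric])
            finally show ?thesis using R(3) by linarith
          qed
        qed
      qed (use opT opS0 in auto)
    qed
    show ?thesis using field_le_epsilon[OF *] by (simp add: g_def)
  qed
  have "((\<lambda>k::real. cmod (f z * exp (- of_real k * z ^ 3))) \<longlongrightarrow> cmod (f z * exp (- of_real 0 * z ^ 3))) (at_right 0)"
    by (intro tendsto_intros)
  then have "cmod (f z * exp (- of_real 0 * z ^ 3)) \<le> B"
    by (rule tendsto_upperbound) (use damp in \<open>auto simp: eventually_at_filter intro!: always_eventually\<close>)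
  then show ?thesis by simp
qed


text \<open>
  Division by \<open>1 - i d z\<close>, which has modulus at least \<open>1\<close> on the half-plane and is
  large far out, makes the bound on large half-discs depend on the boundary values only;
  afterwards \<open>d\<close> tends to \<open>0\<close>.
\<close>

lemma Phragmen_Lindelof_bounded:
  fixes f :: "complex \<Rightarrow> complex"
  assumes cont: "continuous_on {z. 0 \<le> Im z} f" and hol: "f holomorphic_on {z. 0 < Im z}"
    and bound: "\<And>z. 0 \<le> Im z \<Longrightarrow> cmod (f z) \<le> K"
    and bdry: "\<And>x::real. cmod (f (of_real x)) \<le> B"
    and z: "0 \<le> Im z"
  shows "cmod (f z) \<le> B"
proof -
  have B0: "0 \<le> B" using bdry[of 0] norm_ge_zero[of "f (of_real 0)"] by linarith
  have K0: "0 \<le> K" using bound[of 0] norm_ge_zero[of "f 0"] by (simp; linarith)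
  have ge: "1 \<le> cmod (1 - \<i> * of_real d * w)" "d * cmod w \<le> cmod (1 - \<i> * of_real d * w)"
    if "d > 0" "0 \<le> Im w" for d w
  proof -
    have c: "(cmod (1 - \<i> * of_real d * w))\<^sup>2 = 1 + 2 * (d * Im w) + (d * cmod w)\<^sup>2"
      unfolding power_mult_distrib cmod_power2 by (simp add: power2_eq_square algebra_simps)
    have "0 \<le> d * Im w" using that by simp
    then have "1\<^sup>2 \<le> (cmod (1 - \<i> * of_real d * w))\<^sup>2"
      "(d * cmod w)\<^sup>2 \<le> (cmod (1 - \<i> * of_real d * w))\<^sup>2"
      unfolding c by auto
    then show "1 \<le> cmod (1 - \<i> * of_real d * w)" "d * cmod w \<le> cmod (1 - \<i> * of_real d * w)"
      by (auto intro: power2_le_imp_le)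
  qed
  have damp: "cmod (f z) \<le> (B + e) * cmod (1 - \<i> * of_real d * z)" if d: "d > 0" and e: "e > 0" for d e
  proof -
    define g where "g = (\<lambda>w. f w / (1 - \<i> * of_real d * w))"
    define R where "R = max (cmod z) (K / (d * e)) + 1"
    have R: "cmod z \<le> R" "K / (d * e) \<le> R" "0 < R" using norm_ge_zero[of z] unfolding R_def by linarith+
    define T where "T = {w. 0 \<le> Im w \<and> cmod w \<le> R}"
    define T0 where "T0 = {w. 0 < Im w \<and> cmod w < R}"
    have clT: "closed T" unfolding T_def
      by (intro closed_Collect_conj closed_Collect_le continuous_intros)
    have opT: "open T0" unfolding T0_def
      by (intro open_Collect_conj open_Collect_less continuous_intros)
    have nz: "1 - \<i> * of_real d * w \<noteq> 0" if "0 \<le> Im w" for w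
      using ge(1)[OF d that] by auto
    have "cmod (g z) \<le> B + e"
    proof (rule maximum_modulus_compact[where S = T and U = T0 and V = "{z. 0 < Im z}" and f = g])
      show "compact T" using clT by (auto simp: T_def compact_eq_bounded_closed intro!: boundedI)
      show "interior T \<subseteq> {z. 0 < Im z}"
      proof
        fix w assume w: "w \<in> interior T"
        then obtain r where r: "r > 0" "ball w r \<subseteq> T" by (meson mem_interior)
        have "w - \<i> * of_real (r/2) \<in> T" 
          by (rule subsetD[OF r(2)]) (use r(1) in \<open>simp add: dist_norm norm_mult\<close>)
        then show "w \<in> {z. 0 < Im z}" using r(1) unfolding T_def by auto
      qed
      show "g holomorphic_on {z. 0 < Im z}" unfolding g_def
        by (intro holomorphic_intros hol) (use nz in auto)
      have "continuous_on T f" by (rule continuous_on_subset[OF cont]) (auto simp: T_def)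
      then show "continuous_on T g" unfolding g_def
        by (intro continuous_intros) (use nz in \<open>auto simp: T_def\<close>)
      show "z \<in> T" using R z by (auto simp: T_def)
      show "cmod (g w) \<le> B + e" if w: "w \<in> T - T0" for w
      proof -
        have w0: "0 \<le> Im w" using w by (auto simp: T_def)
        consider "Im w = 0" | "cmod w = R" using w by (force simp: T_def T0_def)
        then show ?thesis
        proof cases
          case 1
          then have "w = of_real (Re w)" by (simp add: complex_eq_iff)
          then have "cmod (f w) \<le> B" using bdry[of "Re w"] by simp
          then have "cmod (g w) \<le> B / 1" unfolding g_def norm_divide
            using ge(1)[OF d w0] B0 by (intro frac_le) auto
          then show ?thesis using e by simp
        next
          case 2
          have "cmod (g w) \<le> K / (d * R)" unfolding g_def norm_divide
            using ge(2)[OF d w0] bound[OF w0] K0 R d 2 by (intro frac_le) auto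
          also have "\<dots> \<le> e" using R(2,3) d e by (simp add: field_simps)
          finally show ?thesis using B0 by simp
        qed
      qed
    qed (use opT in \<open>auto simp: T_def T0_def open_halfspace_Im_gt\<close>)
    moreover have "cmod (1 - \<i> * of_real d * z) > 0" using nz[OF z] by simp
    ultimately show ?thesis unfolding g_def norm_divide by (simp add: field_simps)
  qed
  have d: "cmod (f z) \<le> (B + d) * cmod (1 - \<i> * of_real d * z)" if "d > 0" for d
    by (rule damp) (use that in auto)
  have "((\<lambda>d::real. (B + d) * cmod (1 - \<i> * of_real d * z)) \<longlongrightarrow> (B + 0) * cmod (1 - \<i> * of_real 0 * z)) (at_right 0)"
    by (intro tendsto_intros)
  then have "cmod (f z) \<le> (B + 0) * cmod (1 - \<i> * of_real 0 * z)"
    by (rule tendsto_lowerbound) (use d in \<open>auto simp: eventually_at_filter intro!: always_eventually\<close>)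
  then show ?thesis by simp
qed

text \<open>
  The factor \<open>exp (i e z)\<close> makes \<open>f\<close> bounded on the cone
  \<open>3/4 |Re z| \<le> Im z\<close>. What is left are two thin sectors along the real axis,
  with \<open>f\<close> bounded on both sides of each; after a rotation they are the sector of
  the first lemma. Hence the product is bounded on the half-plane, its boundary values control it,
  and \<open>e\<close> may tend to \<open>0\<close>.
\<close>

lemma Phragmen_Lindelof_half_plane:
  fixes f :: "complex \<Rightarrow> complex"
  assumes C: "0 \<le> C" and cont: "continuous_on {z. 0 \<le> Im z} f" and hol: "f holomorphic_on {z. 0 < Im z}"
    and growth: "\<And>z. 0 \<le> Im z \<Longrightarrow> cmod (f z) \<le> exp (C * (1 + cmod z)\<^sup>2)"
    and middle: "\<And>e. e > 0 \<Longrightarrow> \<exists>A. \<forall>z. 3 / 4 * \<bar>Re z\<bar> \<le> Im z \<longrightarrow> cmod (f z) \<le> A * exp (e * Im z)"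
    and bdry: "\<And>x::real. cmod (f (of_real x)) \<le> B"
    and z: "0 \<le> Im z"
  shows "cmod (f z) \<le> B"
proof -
  have damp: "cmod (f z * exp (\<i> * of_real e * z)) \<le> B" if e: "e > 0" for e
  proof -
    define g where "g = (\<lambda>w. f w * exp (\<i> * of_real e * w))"
    have cmg: "cmod (g w) = cmod (f w) * exp (- e * Im w)" for w
      by (simp add: g_def norm_mult)
    have g_le: "cmod (g w) \<le> cmod (f w)" if "0 \<le> Im w" for w
      unfolding cmg using that e by (intro mult_right_le_one_le) auto
    have hg: "g holomorphic_on {z. 0 < Im z}" unfolding g_def by (intro holomorphic_intros hol)
    have cg: "continuous_on {z. 0 \<le> Im z} g" unfolding g_def by (intro continuous_intros cont)
    have bg: "cmod (g (of_real x)) \<le> B" for x :: real using bdry by (simp add: cmg)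
    obtain A where A: "cmod (f w) \<le> A * exp (e * Im w)" if "3 / 4 * \<bar>Re w\<bar> \<le> Im w" for w
      using middle[OF e] by blast
    have mg: "cmod (g w) \<le> A" if "3 / 4 * \<bar>Re w\<bar> \<le> Im w" for w
    proof -
      have "cmod (g w) \<le> A * exp (e * Im w) * exp (- e * Im w)"
        unfolding cmg using A[OF that] by (intro mult_right_mono) auto
      also have "\<dots> = A" by (simp add: exp_add[symmetric])
      finally show ?thesis .
    qed
    have sector: "cmod (g w) \<le> max A B"
      if s: "s = 1 \<or> s = -1" and w: "0 \<le> Im w" "Im w \<le> 3 / 4 * (s * Re w)" for s w
    proof -
      \<comment> \<open>Multiplication by \<open>u = \<plusminus>3 + i\<close> maps one side of the standard sector to the real axis
        and the other one to the ray \<open>Im z = 3/4 |Re z|\<close>.\<close>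
      define u where "u = Complex (3 * s) 1"
      have u: "Re u = 3 * s" "Im u = 1" by (auto simp: u_def)
      have u0: "u \<noteq> 0" by (simp add: u_def complex_eq_iff)
      have cu: "cmod u \<le> 4" using s cmod_le[of u] by (auto simp: u_def)
      have "cmod (g (u * (w / u))) \<le> max A B"
      proof (rule Phragmen_Lindelof_sector[where f = "\<lambda>v. g (u * v)" and C = "16 * C"])
        show "continuous_on {z. \<bar>Im z\<bar> \<le> Re z / 3} (\<lambda>v. g (u * v))"
          by (rule continuous_on_compose2[OF cg]) (use s in \<open>auto intro!: continuous_intros simp: u\<close>)
        have "(g \<circ> (\<lambda>v. u * v)) holomorphic_on {z. \<bar>Im z\<bar> < Re z / 3}"
          by (rule holomorphic_on_compose_gen[OF _ hg]) (use s in \<open>auto intro!: holomorphic_intros simp: u\<close>)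
        then show "(\<lambda>v. g (u * v)) holomorphic_on {z. \<bar>Im z\<bar> < Re z / 3}" by (simp add: o_def)
        show "cmod (g (u * v)) \<le> exp (16 * C * (1 + cmod v)\<^sup>2)" if "v \<in> {z. \<bar>Im z\<bar> \<le> Re z / 3}" for v
        proof -
          have i: "0 \<le> Im (u * v)" using that s by (auto simp: u)
          have "1 + cmod (u * v) \<le> 4 * (1 + cmod v)"
            unfolding norm_mult using mult_right_mono[OF cu norm_ge_zero[of v]] by simp
          then have "(1 + cmod (u * v))\<^sup>2 \<le> (4 * (1 + cmod v))\<^sup>2" by (intro power_mono) auto
          then have "C * (1 + cmod (u * v))\<^sup>2 \<le> C * (4 * (1 + cmod v))\<^sup>2" by (rule mult_left_mono[OF _ C])
          also have "\<dots> = 16 * C * (1 + cmod v)\<^sup>2" unfolding power_mult_distrib by simp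
          finally show ?thesis using g_le[OF i] growth[OF i] by (smt (verit) exp_le_cancel_iff)
        qed
        show "cmod (g (u * v)) \<le> max A B" if v: "\<bar>Im v\<bar> = Re v / 3" for v
        proof -
          have v': "0 \<le> Re v" "Im v = Re v / 3 \<or> Im v = - (Re v / 3)" using v by linarith+
          have "Im (u * v) = 0 \<or> 3 / 4 * \<bar>Re (u * v)\<bar> \<le> Im (u * v)"
            using s v'(2)
            by (elim disjE) (use v'(1) in \<open>simp_all add: u\<close>)
          then consider "Im (u * v) = 0" | "3 / 4 * \<bar>Re (u * v)\<bar> \<le> Im (u * v)"
            by blast
          then show ?thesis
          proof cases
            case 1
            then have "u * v = of_real (Re (u * v))" by (simp add: complex_eq_iff)
            then show ?thesis using bg[of "Re (u * v)"] by simp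
          next
            case 2
            then show ?thesis using mg by (metis max.coboundedI1)
          qed
        qed
        define v where "v = w / u"
        have "w = u * v" using u0 by (simp add: v_def)
        then have "\<bar>Im v\<bar> \<le> Re v / 3" using w s by (auto simp: u)
        then show "w / u \<in> {z. \<bar>Im z\<bar> \<le> Re z / 3}" by (simp add: v_def)
      qed (use C in auto)
      then show ?thesis using u0 by simp
    qed
    have "cmod (g w) \<le> max A B" if w: "0 \<le> Im w" for w
    proof -
      consider "3 / 4 * \<bar>Re w\<bar> \<le> Im w" | "Im w \<le> 3 / 4 * (1 * Re w)" | "Im w \<le> 3 / 4 * (-1 * Re w)"
        by linarith
      then show ?thesis
      proof cases
        case 1
        then show ?thesis using mg[of w] by simp
      next
        case 2
        then show ?thesis using sector[of 1 w] w by simp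
      next
        case 3
        then show ?thesis using sector[of "-1" w] w by simp
      qed
    qed
    then have "cmod (g z) \<le> B"
      by (rule Phragmen_Lindelof_bounded[OF cg hg _ bg z])
    then show ?thesis by (simp add: g_def)
  qed
  have "((\<lambda>e::real. cmod (f z * exp (\<i> * of_real e * z))) \<longlongrightarrow> cmod (f z * exp (\<i> * of_real 0 * z))) (at_right 0)"
    by (intro tendsto_intros)
  then have "cmod (f z * exp (\<i> * of_real 0 * z)) \<le> B"
    by (rule tendsto_upperbound) (use damp in \<open>auto simp: eventually_at_filter intro!: always_eventually\<close>)
  then show ?thesis by simp
qed

section \<open>Hardy functions and their energy on horizontal lines\<close>

lemma nn_integral_interval:
  fixes h :: "real \<Rightarrow> real"
  assumes "continuous_on {p..q} h" "\<And>x. 0 \<le> h x"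
  shows "(\<integral>\<^sup>+x. ennreal (h x) * indicator {p..q} x \<partial>lborel) = ennreal (integral {p..q} h)"
proof -
  have i: "set_integrable lborel {p..q} h" by (rule borel_integrable_atLeastAtMost'[OF assms(1)])
  have "(\<integral>\<^sup>+x. ennreal (h x) * indicator {p..q} x \<partial>lborel) = (\<integral>\<^sup>+x. ennreal (indicator {p..q} x *\<^sub>R h x) \<partial>lborel)"
    by (rule nn_integral_cong) (auto simp: indicator_def)
  also have "\<dots> = ennreal (LINT x|lborel. indicator {p..q} x *\<^sub>R h x)"
    using i assms(2) by (intro nn_integral_eq_integral) (auto simp: set_integrable_def)
  also have "(LINT x|lborel. indicator {p..q} x *\<^sub>R h x) = integral {p..q} h"
    using set_borel_integral_eq_integral(2)[OF i] by (simp add: set_lebesgue_integral_def)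
  finally show ?thesis .
qed

text \<open>
  Translates the extended nonnegative integrals in the definition of the Hardy space into
  Riemann-type integrals over compact intervals, which depend continuously and holomorphically
  on parameters.
\<close>

lemma nn_integral_le_iff_integral_le:
  fixes h :: "real \<Rightarrow> real"
  assumes cont: "continuous_on UNIV h" and nn: "\<And>x. 0 \<le> h x" and S: "0 \<le> S"
  shows "(\<integral>\<^sup>+x. ennreal (h x) \<partial>lborel) \<le> ennreal S \<longleftrightarrow> (\<forall>L>0. integral {-L..L} h \<le> S)"
proof
  have eq: "(\<integral>\<^sup>+x. ennreal (h x) * indicator {p..q} x \<partial>lborel) = ennreal (integral {p..q} h)" for p q
    by (rule nn_integral_interval) (use cont nn in \<open>auto intro: continuous_on_subset\<close>)
  {
    assume le: "(\<integral>\<^sup>+x. ennreal (h x) \<partial>lborel) \<le> ennreal S"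
    show "\<forall>L>0. integral {-L..L} h \<le> S"
    proof (intro allI impI)
      fix L :: real
      have "ennreal (integral {-L..L} h) \<le> (\<integral>\<^sup>+x. ennreal (h x) \<partial>lborel)"
        unfolding eq[symmetric] by (intro nn_integral_mono) (auto simp: indicator_def)
      with le have "ennreal (integral {-L..L} h) \<le> ennreal S" by (rule order_trans[rotated])
      then show "integral {-L..L} h \<le> S" using S by (simp add: ennreal_le_iff)
    qed
  }
  assume le: "\<forall>L>0. integral {-L..L} h \<le> S"
  define u where "u = (\<lambda>n::nat. \<lambda>x. ennreal (h x) * indicator {- real (Suc n)..real (Suc n)} x)"
  have m: "h \<in> borel_measurable borel" using cont by (rule borel_measurable_continuous_onI)
  have "(SUP n. u n x) = ennreal (h x)" for x
  proof (rule antisym)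
    show "(SUP n. u n x) \<le> ennreal (h x)" by (rule SUP_least) (auto simp: u_def indicator_def)
    obtain n where "\<bar>x\<bar> < real n" using reals_Archimedean2 by blast
    then have "u n x = ennreal (h x)" by (auto simp: u_def indicator_def)
    then show "ennreal (h x) \<le> (SUP n. u n x)" by (metis SUP_upper UNIV_I)
  qed
  then have "(\<integral>\<^sup>+x. ennreal (h x) \<partial>lborel) = (\<integral>\<^sup>+x. (SUP n. u n x) \<partial>lborel)" by simp
  also have "\<dots> = (SUP n. \<integral>\<^sup>+x. u n x \<partial>lborel)"
  proof (rule nn_integral_monotone_convergence_SUP)
    show "incseq u" unfolding u_def by (auto simp: incseq_def le_fun_def indicator_def)
    show "u n \<in> borel_measurable lborel" for n unfolding u_def using m by measurable
  qed
  also have "\<dots> \<le> ennreal S"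
    unfolding u_def eq by (intro SUP_least ennreal_leI le[rule_format]) simp
  finally show "(\<integral>\<^sup>+x. ennreal (h x) \<partial>lborel) \<le> ennreal S" .
qed

lemma upper_half_plane_props [simp]:
  "open upper_half_plane" "convex upper_half_plane" "z \<in> upper_half_plane \<longleftrightarrow> 0 < Im z"
  by (auto simp: upper_half_plane_def open_halfspace_Im_gt convex_halfspace_Im_gt)

lemma continuous_on_horizontal_line:
  assumes "continuous_on A F" "\<And>x. x \<in> B \<Longrightarrow> Complex x y \<in> A"
  shows "continuous_on B (\<lambda>x. F (Complex x y))"
  by (rule continuous_on_compose2[OF assms(1)]) (use assms(2) in \<open>auto simp: Complex_eq intro!: continuous_intros\<close>)

text \<open>
  A bound on the square mean along the horizontal line at height \<open>y\<close>, read off from compact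
  intervals. For continuous \<open>F\<close> it needs no separate statement about integrability over
  the whole line.
\<close>

definition line_energy_le :: "(complex \<Rightarrow> complex) \<Rightarrow> real \<Rightarrow> real \<Rightarrow> bool" where
  "line_energy_le F y S \<longleftrightarrow> (\<forall>L>0. integral {-L..L} (\<lambda>x. (cmod (F (Complex x y)))\<^sup>2) \<le> S)"

lemma line_energy_le_iff_nn_integral:
  assumes "continuous_on UNIV (\<lambda>x. F (Complex x y))" "0 \<le> S"
  shows "line_energy_le F y S \<longleftrightarrow> (\<integral>\<^sup>+ x. ennreal ((cmod (F (Complex x y)))\<^sup>2) \<partial>lborel) \<le> ennreal S"
  unfolding line_energy_le_def
  by (rule nn_integral_le_iff_integral_le[symmetric]) (use assms in \<open>auto intro!: continuous_intros\<close>)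

lemma hardy_H2_iff:
  "F \<in> hardy_H2 \<longleftrightarrow> F holomorphic_on upper_half_plane \<and> (\<exists>S>0. \<forall>y>0. line_energy_le F y S)"
proof (cases "F holomorphic_on upper_half_plane")
  case True
  have c: "continuous_on UNIV (\<lambda>x. F (Complex x y))" if "y > 0" for y
    by (rule continuous_on_horizontal_line[OF holomorphic_on_imp_continuous_on[OF True]]) (use that in simp)
  define I where "I = (\<lambda>y. \<integral>\<^sup>+ x. ennreal ((cmod (F (Complex x y)))\<^sup>2) \<partial>lborel)"
  have eq: "line_energy_le F y S \<longleftrightarrow> I y \<le> ennreal S" if "y > 0" "S > 0" for y S
    unfolding I_def using that by (intro line_energy_le_iff_nn_integral c) auto
  have "(SUP y\<in>{0<..}. I y) < \<infinity> \<longleftrightarrow> (\<exists>S>0. \<forall>y>0. I y \<le> ennreal S)"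
  proof
    assume fin: "(SUP y\<in>{0<..}. I y) < \<infinity>"
    define S where "S = enn2real (SUP y\<in>{0<..}. I y) + 1"
    have "I y \<le> ennreal S" if "y > 0" for y
    proof -
      have "I y \<le> (SUP y\<in>{0<..}. I y)" by (rule SUP_upper) (use that in simp)
      also have "\<dots> = ennreal (enn2real (SUP y\<in>{0<..}. I y))" using fin by simp
      also have "\<dots> \<le> ennreal S" unfolding S_def by (rule ennreal_leI) simp
      finally show ?thesis .
    qed
    moreover have "S > 0" by (simp add: S_def add_nonneg_pos)
    ultimately show "\<exists>S>0. \<forall>y>0. I y \<le> ennreal S" by blast
  next
    assume "\<exists>S>0. \<forall>y>0. I y \<le> ennreal S"
    then obtain S where "\<forall>y>0. I y \<le> ennreal S" by blast
    then have "(SUP y\<in>{0<..}. I y) \<le> ennreal S" by (intro SUP_least) auto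
    then show "(SUP y\<in>{0<..}. I y) < \<infinity>" by (simp add: le_less_trans)
  qed
  then show ?thesis using True eq unfolding hardy_H2_def I_def by auto
qed (simp add: hardy_H2_def)

lemma line_energy_interval:
  assumes "line_energy_le F y S" "continuous_on UNIV (\<lambda>x. F (Complex x y))"
  shows "integral {p..q} (\<lambda>x. (cmod (F (Complex x y)))\<^sup>2) \<le> S"
proof -
  define L where "L = \<bar>p\<bar> + \<bar>q\<bar> + 1"
  have c: "continuous_on A (\<lambda>x. (cmod (F (Complex x y)))\<^sup>2)" for A
    by (intro continuous_intros continuous_on_subset[OF assms(2)]) auto
  have "integral {p..q} (\<lambda>x. (cmod (F (Complex x y)))\<^sup>2) \<le> integral {-L..L} (\<lambda>x. (cmod (F (Complex x y)))\<^sup>2)"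
    by (rule integral_subset_le) (auto simp: L_def intro!: integrable_continuous_interval c)
  also have "\<dots> \<le> S" using assms(1)[unfolded line_energy_le_def, rule_format, of L] by (simp add: L_def)
  finally show ?thesis .
qed

lemma line_energy_shift:
  assumes "line_energy_le F (Im z) S" "continuous_on UNIV (\<lambda>x. F (Complex x (Im z)))"
  shows "integral {p..q} (\<lambda>s. (cmod (F (z + of_real s)))\<^sup>2) \<le> S"
proof -
  have "integral {p..q} ((\<lambda>x. (cmod (F (Complex x (Im z))))\<^sup>2) \<circ> (\<lambda>s. s + Re z))
      = integral {p + Re z..q + Re z} (\<lambda>x. (cmod (F (Complex x (Im z))))\<^sup>2)"
    by (rule integral_shift) (intro continuous_intros continuous_on_subset[OF assms(2)]; simp)
  also have "\<dots> \<le> S" by (rule line_energy_interval[OF assms])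
  also have "(\<lambda>x. (cmod (F (Complex x (Im z))))\<^sup>2) \<circ> (\<lambda>s. s + Re z) = (\<lambda>s. (cmod (F (z + of_real s)))\<^sup>2)"
  proof -
    have "Complex (s + Re z) (Im z) = z + of_real s" for s by (simp add: complex_eq_iff)
    then show ?thesis by (simp add: o_def)
  qed
  finally show ?thesis .
qed

text \<open>
  If \<open>H\<close> is a primitive of \<open>F^2\<close>, then \<open>H(z + L) - H(z)\<close> is the integral of
  \<open>F^2\<close> along a horizontal segment, hence bounded by \<open>S\<close> on the half-plane. Cauchy's
  inequality for its derivative \<open>F(z + L)^2 - F(z)^2\<close> shows that \<open>F^2\<close> varies by at most
  \<open>2 S / y\<close> along the line at height \<open>y\<close>; and somewhere on this line \<open>|F|^2\<close> is at
  most \<open>S / y\<close>.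
\<close>

lemma hardy_pointwise_bound:
  assumes hol: "F holomorphic_on upper_half_plane" and S: "S > 0" and en: "\<And>y. y > 0 \<Longrightarrow> line_energy_le F y S"
    and z: "Im z > 0"
  shows "(cmod (F z))\<^sup>2 \<le> 3 * S / Im z"
proof -
  define y where "y = Im z"
  have y: "y > 0" using z by (simp add: y_def)
  have contF: "continuous_on upper_half_plane F" by (rule holomorphic_on_imp_continuous_on[OF hol])
  have lineF: "continuous_on UNIV (\<lambda>x. F (Complex x (Im w)))" if "Im w > 0" for w
    by (rule continuous_on_horizontal_line[OF contF]) (use that in simp)
  have contS: "continuous_on A (\<lambda>s. F (w + of_real s))" if "Im w > 0" for A w
    by (rule continuous_on_compose2[OF contF]) (use that in \<open>auto intro!: continuous_intros\<close>)
  have energy: "integral {p..q} (\<lambda>s. (cmod (F (w + of_real s)))\<^sup>2) \<le> S" if "Im w > 0" for p q w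
    by (rule line_energy_shift[OF en[OF that] lineF[OF that]])
  obtain H where H: "\<And>w. w \<in> upper_half_plane \<Longrightarrow> (H has_field_derivative (F w)\<^sup>2) (at w within upper_half_plane)"
    using holomorphic_convex_primitive'[of upper_half_plane "\<lambda>w. (F w)\<^sup>2"] hol
    by (auto intro!: holomorphic_intros)
  have H': "(H has_field_derivative (F w)\<^sup>2) (at w)" if "Im w > 0" for w
    using H[of w] that by (simp add: at_within_open[of w upper_half_plane])
  have diff: "cmod ((F (z + of_real L))\<^sup>2 - (F z)\<^sup>2) \<le> 2 * S / y" if L: "L > 0" for L
  proof -
    define D where "D = (\<lambda>w. H (w + of_real L) - H w)"
    have D': "(D has_field_derivative ((F (w + of_real L))\<^sup>2 - (F w)\<^sup>2)) (at w)" if "Im w > 0" for w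
    proof -
      have "((\<lambda>w. H (w + of_real L)) has_field_derivative (F (w + of_real L))\<^sup>2) (at w)"
        using H'[of "w + of_real L"] that by (subst DERIV_shift[symmetric]) simp
      then show ?thesis unfolding D_def by (rule DERIV_diff[OF _ H'[OF that]])
    qed
    have DS: "cmod (D w) \<le> S" if w: "Im w > 0" for w
    proof -
      have "((\<lambda>s. (F (w + of_real s))\<^sup>2) has_integral H (w + of_real L) - H (w + of_real 0)) {0..L}"
      proof (rule fundamental_theorem_of_calculus)
        fix s assume "s \<in> {0..L}"
        have "((\<lambda>s. H (w + s)) has_field_derivative (F (w + of_real s))\<^sup>2) (at (of_real s))"
          using DERIV_shift[THEN iffD1, OF H'[of "of_real s + w"]] w by (simp add: add.commute)
        then show "((\<lambda>s. H (w + of_real s)) has_vector_derivative (F (w + of_real s))\<^sup>2) (at s within {0..L})"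
          by (rule has_vector_derivative_real_field)
      qed (use L in simp)
      then have "D w = integral {0..L} (\<lambda>s. (F (w + of_real s))\<^sup>2)"
        by (simp add: D_def integral_unique)
      also have "cmod \<dots> \<le> integral {0..L} (\<lambda>s. (cmod (F (w + of_real s)))\<^sup>2)"
        by (rule integral_norm_bound_integral)
          (auto intro!: integrable_continuous_interval continuous_intros contS w simp: norm_power)
      also have "\<dots> \<le> S" by (rule energy[OF w])
      finally show ?thesis .
    qed
    have in_cball: "Im w > 0" if "w \<in> cball z (y/2)" for w
      using abs_Im_le_cmod[of "z - w"] that y by (auto simp: dist_norm y_def)
    have "cmod ((deriv ^^ 1) D z) \<le> fact 1 * S / (y/2) ^ 1"
    proof (rule Cauchy_inequality)
      show "continuous_on (cball z (y/2)) D"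
        using D' in_cball by (meson DERIV_isCont continuous_at_imp_continuous_on)
      show "D holomorphic_on ball z (y/2)"
        unfolding holomorphic_on_def field_differentiable_def
        using D' in_cball by (meson DERIV_subset ball_subset_cball subsetD top_greatest)
      show "cmod (D w) \<le> S" if "cmod (z - w) = y/2" for w
        by (rule DS, rule in_cball) (use that in \<open>simp add: dist_norm\<close>)
    qed (use y in auto)
    then show ?thesis using DERIV_imp_deriv[OF D'[OF z]] by (simp add: mult.commute)
  qed
  have "\<exists>L\<in>{y..3*y}. (cmod (F (z + of_real L)))\<^sup>2 \<le> S / y"
  proof (rule ccontr)
    assume "\<not> ?thesis"
    then have "integral {y..3*y} (\<lambda>s. S / y) \<le> integral {y..3*y} (\<lambda>s. (cmod (F (z + of_real s)))\<^sup>2)"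
      by - (rule integral_le, auto intro!: integrable_continuous_interval continuous_intros contS z simp: not_le less_imp_le)
    also have "\<dots> \<le> S" by (rule energy[OF z])
    finally show False using S y by simp
  qed
  then obtain L where L: "L \<ge> y" "(cmod (F (z + of_real L)))\<^sup>2 \<le> S / y" by auto
  have "(cmod (F z))\<^sup>2 = cmod ((F z)\<^sup>2)" by (simp add: norm_power)
  also have "\<dots> \<le> cmod ((F (z + of_real L))\<^sup>2) + cmod ((F (z + of_real L))\<^sup>2 - (F z)\<^sup>2)"
    by (metis norm_minus_commute norm_triangle_sub)
  also have "\<dots> \<le> S / y + 2 * S / y" using L y diff[of L] by (simp add: norm_power)
  also have "\<dots> = 3 * S / Im z" by (simp add: y_def)
  finally show ?thesis .
qed

lemma line_energy_boundary:
  assumes cont: "continuous_on {z. 0 \<le> Im z} F" and en: "\<And>y. y > 0 \<Longrightarrow> line_energy_le F y S"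
  shows "line_energy_le F 0 S"
  unfolding line_energy_le_def
proof (intro allI impI)
  fix L :: real assume L: "L > 0"
  define I where "I = (\<lambda>y. integral {-L..L} (\<lambda>x. (cmod (F (Complex x y)))\<^sup>2))"
  have "continuous_on ({0..} \<times> cbox (-L) L) (\<lambda>(y, x). (cmod (F (Complex x y)))\<^sup>2)"
    unfolding case_prod_beta Complex_eq
    by (intro continuous_intros continuous_on_compose2[OF cont]) auto
  then have "continuous_on {0..} I"
    using integral_continuous_on_param[of "{0::real..}" "-L" L "\<lambda>y x. (cmod (F (Complex x y)))\<^sup>2"] by (simp add: I_def)
  then have "(I \<longlongrightarrow> I 0) (at 0 within {0..})" by (simp add: continuous_on_def)
  then have "(I \<longlongrightarrow> I 0) (at_right 0)" by (rule tendsto_within_subset) auto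
  then have "I 0 \<le> S"
    by (rule tendsto_upperbound)
      (use en L in \<open>auto simp: eventually_at_filter I_def line_energy_le_def intro!: always_eventually\<close>)
  then show "integral {-L..L} (\<lambda>x. (cmod (F (Complex x 0)))\<^sup>2) \<le> S" by (simp add: I_def)
qed

lemma line_energy_nonneg:
  assumes "line_energy_le F y S" shows "0 \<le> S"
proof -
  have "0 \<le> integral {-1..1} (\<lambda>x. (cmod (F (Complex x y)))\<^sup>2)"
    by (cases "(\<lambda>x. (cmod (F (Complex x y)))\<^sup>2) integrable_on {-1..1}")
      (auto intro: integral_nonneg simp: not_integrable_integral)
  also have "\<dots> \<le> S" using assms unfolding line_energy_le_def by force
  finally show ?thesis .
qed

lemma line_energy_mono: "line_energy_le F y N \<Longrightarrow> N \<le> N' \<Longrightarrow> line_energy_le F y N'"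
  unfolding line_energy_le_def by (meson order_trans)

section \<open>A Phragmen-Lindelof principle in the square mean\<close>

text \<open>
  For a fixed square integrable \<open>g\<close> on \<open>[-L, L]\<close> the averages
  \<open>\<Phi>(z) = \<integral> F(z + s) g(s) ds\<close> form a holomorphic function, and the scalar principle
  applies to it: on the real line it is bounded by the mean square of \<open>F\<close> and \<open>g\<close>. With
  \<open>g(s) = cnj (F(s + i y))\<close> the value \<open>\<Phi>(i y)\<close> is the energy of \<open>F\<close> on
  \<open>[-L, L]\<close> at height \<open>y\<close>. The averaging is also the reason why it suffices to control
  the factor \<open>Q\<close> of \<open>F\<close> in the square mean, although it may be unbounded near the
  real line.
\<close>

lemma L2_Phragmen_Lindelof:
  fixes F P Q :: "complex \<Rightarrow> complex"
  assumes cont: "continuous_on {z. 0 \<le> Im z} F" and hol: "F holomorphic_on {z. 0 < Im z}"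
    and contP: "continuous_on {z. 0 < Im z} P" and contQ: "continuous_on {z. 0 < Im z} Q"
    and factor: "\<And>z. 0 < Im z \<Longrightarrow> F z = P z * Q z"
    and C: "0 \<le> C" and growth: "\<And>z. 0 < Im z \<Longrightarrow> cmod (P z) \<le> exp (C * (1 + cmod z)\<^sup>2)"
    and S: "0 \<le> S" and energyQ: "\<And>y. y > 0 \<Longrightarrow> line_energy_le Q y S"
    and cone: "\<And>e. e > 0 \<Longrightarrow> \<exists>A r. \<forall>z. r \<le> Im z \<and> \<bar>Re z\<bar> \<le> 2 * Im z \<longrightarrow> cmod (F z) \<le> A * exp (e * Im z)"
    and N: "0 \<le> N" and bdry: "line_energy_le F 0 N"
    and y: "0 < y"
  shows "line_energy_le F y N"
  unfolding line_energy_le_def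
proof (intro allI impI)
  fix L :: real assume L: "L > 0"
  define g where "g = (\<lambda>s. cnj (F (Complex s y)))"
  define I where "I = integral {-L..L} (\<lambda>s. (cmod (g s))\<^sup>2)"
  define \<Phi> where "\<Phi> = (\<lambda>z. integral {-L..L} (\<lambda>s. F (z + of_real s) * g s))"
  have contg: "continuous_on A g" for A
    unfolding g_def by (intro continuous_intros continuous_on_horizontal_line[OF cont]) (use y in auto)
  have I0: "0 \<le> I" unfolding I_def by (rule integral_nonneg) (auto intro!: integrable_continuous_interval continuous_intros contg)
  have contF: "continuous_on A (\<lambda>s. F (z + of_real s))" if "0 \<le> Im z" for A z
    by (rule continuous_on_compose2[OF cont]) (use that in \<open>auto intro!: continuous_intros\<close>)
  have shift: "continuous_on A (\<lambda>s. G (z + of_real s))" if "continuous_on {z. 0 < Im z} G" "0 < Im z" for G :: "complex \<Rightarrow> complex" and A z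
    by (rule continuous_on_compose2[OF that(1)]) (use that in \<open>auto intro!: continuous_intros\<close>)

  have \<Phi>_cont: "continuous_on {z. 0 \<le> Im z} \<Phi>"
  proof -
    have "continuous_on ({z. 0 \<le> Im z} \<times> cbox (-L) L) (\<lambda>(z, s). F (z + of_real s) * g s)"
      unfolding case_prod_beta
      by (intro continuous_intros continuous_on_compose2[OF cont] continuous_on_compose2[OF contg[of UNIV]]) auto
    then show ?thesis
      using integral_continuous_on_param[of "{z. 0 \<le> Im z}" "-L" L "\<lambda>z s. F (z + of_real s) * g s"]
      by (simp add: \<Phi>_def)
  qed
  have \<Phi>_hol: "\<Phi> holomorphic_on {z. 0 < Im z}"
  proof -
    have op: "open {z. 0 < Im z}" by (rule open_halfspace_Im_gt)
    have F': "(F has_field_derivative deriv F w) (at w)" if "0 < Im w" for w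
      using holomorphic_derivI[OF hol op] that by simp
    have "(\<lambda>z. integral (cbox (-L) L) (\<lambda>s. F (z + of_real s) * g s)) holomorphic_on {z. 0 < Im z}"
    proof (rule leibniz_rule_holomorphic)
      show "((\<lambda>z. F (z + of_real s) * g s) has_field_derivative deriv F (z + of_real s) * g s) (at z within {z. 0 < Im z})"
        if "z \<in> {z. 0 < Im z}" for z s
      proof -
        have "((\<lambda>z. F (z + of_real s)) has_field_derivative deriv F (z + of_real s)) (at z)"
          by (rule DERIV_shift[THEN iffD1, OF F']) (use that in simp)
        then show ?thesis by (rule DERIV_cmult_right[OF has_field_derivative_at_within])
      qed
      show "(\<lambda>s. F (z + of_real s) * g s) integrable_on cbox (-L) L" if "z \<in> {z. 0 < Im z}" for z
        by (intro integrable_continuous continuous_intros contF contg) (use that in auto)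
      have contF': "continuous_on {z. 0 < Im z} (deriv F)"
        by (intro holomorphic_on_imp_continuous_on holomorphic_deriv hol op)
      show "continuous_on ({z. 0 < Im z} \<times> cbox (-L) L) (\<lambda>(z, s). deriv F (z + of_real s) * g s)"
        unfolding case_prod_beta
        by (intro continuous_intros continuous_on_compose2[OF contF'] continuous_on_compose2[OF contg[of UNIV]]) auto
      show "convex {z. 0 < Im z}" by (rule convex_halfspace_Im_gt)
    qed
    then show ?thesis by (simp add: \<Phi>_def)
  qed
  \<comment> \<open>The inequality \<open>2 |G g| \<le> |G|^2 + |g|^2\<close> takes the place of the Cauchy-Schwarz
    inequality; nothing is lost, because in the end \<open>I \<le> (N + I) / 2\<close> already gives \<open>I \<le> N\<close>.\<close>
  have young: "cmod (\<Phi> z) \<le> K * ((integral {-L..L} (\<lambda>s. (cmod (G (z + of_real s)))\<^sup>2) + I) / 2)"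
    if z: "0 \<le> Im z" and K: "0 \<le> K" and G: "continuous_on {-L..L} (\<lambda>s. G (z + of_real s))"
      and le: "\<And>s. \<bar>s\<bar> \<le> L \<Longrightarrow> cmod (F (z + of_real s)) \<le> K * cmod (G (z + of_real s))" for z K and G :: "complex \<Rightarrow> complex"
  proof -
    have "cmod (\<Phi> z) \<le> integral {-L..L} (\<lambda>s. K * (((cmod (G (z + of_real s)))\<^sup>2 + (cmod (g s))\<^sup>2) / 2))"
      unfolding \<Phi>_def
    proof (rule integral_norm_bound_integral)
      fix s assume s: "s \<in> {-L..L}"
      have "cmod (F (z + of_real s) * g s) \<le> (K * cmod (G (z + of_real s))) * cmod (g s)"
        unfolding norm_mult by (rule mult_right_mono[OF le]) (use s in auto)
      also have "\<dots> = K * (cmod (G (z + of_real s)) * cmod (g s))" by simp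
      also have "\<dots> \<le> K * (((cmod (G (z + of_real s)))\<^sup>2 + (cmod (g s))\<^sup>2) / 2)"
        using sum_squares_bound[of "cmod (G (z + of_real s))" "cmod (g s)"] K by (intro mult_left_mono) auto
      finally show "cmod (F (z + of_real s) * g s) \<le> K * (((cmod (G (z + of_real s)))\<^sup>2 + (cmod (g s))\<^sup>2) / 2)" .
    qed (auto intro!: integrable_continuous_interval continuous_intros contF[OF z] contg G)
    also have "\<dots> = K * ((integral {-L..L} (\<lambda>s. (cmod (G (z + of_real s)))\<^sup>2) + I) / 2)"
      unfolding I_def
      by (simp, subst integral_add) (auto intro!: integrable_continuous_interval continuous_intros contg G)
    finally show ?thesis .
  qed
  have \<Phi>_real: "cmod (\<Phi> (of_real x)) \<le> (N + I) / 2" for x :: real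
  proof -
    have "cmod (\<Phi> (of_real x)) \<le> 1 * ((integral {-L..L} (\<lambda>s. (cmod (F (of_real x + of_real s)))\<^sup>2) + I) / 2)"
      by (rule young) (auto intro!: contF)
    also have "integral {-L..L} (\<lambda>s. (cmod (F (of_real x + of_real s)))\<^sup>2) \<le> N"
      by (rule line_energy_shift) (use bdry in \<open>auto intro!: continuous_on_horizontal_line[OF cont]\<close>)
    finally show ?thesis by simp
  qed
  define C1 where "C1 = C * (1 + L)\<^sup>2 + (S + N + I)"
  have C1: "0 \<le> C1" using C S N I0 by (simp add: C1_def)
  have \<Phi>_growth: "cmod (\<Phi> z) \<le> exp (C1 * (1 + cmod z)\<^sup>2)" if z: "0 \<le> Im z" for z
  proof -
    have one: "1 \<le> (1 + cmod z)\<^sup>2" by (simp add: one_le_power)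
    have lin: "t \<le> exp ((S + N + I) * (1 + cmod z)\<^sup>2)" if "t \<le> S + N + I" for t
    proof -
      have "t \<le> (S + N + I) * (1 + cmod z)\<^sup>2"
        using mult_left_mono[OF one, of "S + N + I"] S N I0 that by simp
      then show ?thesis using exp_ge_add_one_self[of "(S + N + I) * (1 + cmod z)\<^sup>2"] by linarith
    qed
    show ?thesis
    proof (cases "Im z = 0")
      case True
      then have "z = of_real (Re z)" by (simp add: complex_eq_iff)
      then have "cmod (\<Phi> z) \<le> (N + I) / 2" using \<Phi>_real by metis
      also have "\<dots> \<le> exp ((S + N + I) * (1 + cmod z)\<^sup>2)" by (rule lin) (use S N I0 in simp)
      also have "\<dots> \<le> exp (C1 * (1 + cmod z)\<^sup>2)"
        using C by (auto simp: C1_def intro!: mult_right_mono)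
      finally show ?thesis .
    next
      case False
      then have z': "0 < Im z" using z by simp
      define K where "K = exp (C * (1 + L)\<^sup>2 * (1 + cmod z)\<^sup>2)"
      have "cmod (\<Phi> z) \<le> K * ((integral {-L..L} (\<lambda>s. (cmod (Q (z + of_real s)))\<^sup>2) + I) / 2)"
      proof (rule young[OF z])
        fix s :: real assume s: "\<bar>s\<bar> \<le> L"
        have "1 + cmod (z + of_real s) \<le> 1 + (cmod z + L)"
          using norm_triangle_ineq[of z "of_real s"] s by simp
        also have "\<dots> \<le> (1 + L) * (1 + cmod z)" using L by (simp add: algebra_simps)
        finally have "(1 + cmod (z + of_real s))\<^sup>2 \<le> ((1 + L) * (1 + cmod z))\<^sup>2" by (intro power_mono) auto
        then have "C * (1 + cmod (z + of_real s))\<^sup>2 \<le> C * ((1 + L) * (1 + cmod z))\<^sup>2" by (rule mult_left_mono[OF _ C])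
        then have "cmod (P (z + of_real s)) \<le> K"
          using growth[of "z + of_real s"] z' unfolding K_def power_mult_distrib
          by (smt (verit) exp_le_cancel_iff mult.assoc Im_complex_of_real plus_complex.simps(2))
        then show "cmod (F (z + of_real s)) \<le> K * cmod (Q (z + of_real s))"
          using z' by (simp add: factor norm_mult mult_right_mono)
      qed (auto simp: K_def intro: shift[OF contQ z'])
      also have "\<dots> \<le> K * (S + N + I)"
      proof (rule mult_left_mono)
        have half: "(t + I) / 2 \<le> S + N + I" if "t \<le> S" for t using that S N I0 by simp
        have "integral {-L..L} (\<lambda>s. (cmod (Q (z + of_real s)))\<^sup>2) \<le> S"
          by (rule line_energy_shift) (use z' energyQ in \<open>auto intro!: continuous_on_horizontal_line[OF contQ]\<close>)
        then show "(integral {-L..L} (\<lambda>s. (cmod (Q (z + of_real s)))\<^sup>2) + I) / 2 \<le> S + N + I"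
          by (rule half)
      qed (simp add: K_def)
      also have "\<dots> \<le> K * exp ((S + N + I) * (1 + cmod z)\<^sup>2)"
        by (rule mult_left_mono[OF lin]) (auto simp: K_def)
      also have "\<dots> = exp (C1 * (1 + cmod z)\<^sup>2)"
        by (simp add: K_def C1_def exp_add[symmetric] algebra_simps)
      finally show ?thesis .
    qed
  qed
  have \<Phi>_cone: "\<exists>A. \<forall>z. 3 / 4 * \<bar>Re z\<bar> \<le> Im z \<longrightarrow> cmod (\<Phi> z) \<le> A * exp (e * Im z)" if e: "e > 0" for e
  proof -
    obtain A r where Ar: "cmod (F z) \<le> A * exp (e * Im z)" if "r \<le> Im z" "\<bar>Re z\<bar> \<le> 2 * Im z" for z
      using cone[OF e] by blast
    define R where "R = max r (2 * L)"
    have "cmod (\<Phi> z) \<le> max (exp (C1 * (1 + 3 * R)\<^sup>2)) (\<bar>A\<bar> * ((2 * L + I) / 2)) * exp (e * Im z)"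
      if z: "3 / 4 * \<bar>Re z\<bar> \<le> Im z" for z
    proof (cases "Im z \<le> R")
      case True
      have z0: "0 \<le> Im z" using z by linarith
      have "cmod z \<le> \<bar>Re z\<bar> + \<bar>Im z\<bar>" by (rule cmod_le)
      then have "1 + cmod z \<le> 1 + 3 * R" using z True by linarith
      then have "(1 + cmod z)\<^sup>2 \<le> (1 + 3 * R)\<^sup>2" by (intro power_mono) auto
      then have "cmod (\<Phi> z) \<le> exp (C1 * (1 + 3 * R)\<^sup>2)"
        using \<Phi>_growth[OF z0] mult_left_mono[OF _ C1] by (meson exp_le_cancel_iff order_trans)
      also have "\<dots> \<le> exp (C1 * (1 + 3 * R)\<^sup>2) * exp (e * Im z)"
        using e z0 by simp
      also have "\<dots> \<le> max (exp (C1 * (1 + 3 * R)\<^sup>2)) (\<bar>A\<bar> * ((2 * L + I) / 2)) * exp (e * Im z)"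
        by (rule mult_right_mono) auto
      finally show ?thesis .
    next
      case False
      then have z1: "r \<le> Im z" "2 * L \<le> Im z" by (auto simp: R_def)
      have "cmod (\<Phi> z) \<le> (\<bar>A\<bar> * exp (e * Im z)) * ((integral {-L..L} (\<lambda>s. (cmod 1)\<^sup>2) + I) / 2)"
      proof (rule young)
        fix s :: real assume s: "\<bar>s\<bar> \<le> L"
        have "cmod (F (z + of_real s)) \<le> A * exp (e * Im (z + of_real s))"
          by (rule Ar) (use z z1 s L in auto)
        also have "\<dots> \<le> \<bar>A\<bar> * exp (e * Im z)" by (simp add: mult_right_mono)
        finally show "cmod (F (z + of_real s)) \<le> \<bar>A\<bar> * exp (e * Im z) * cmod 1" by simp
      qed (use z1 L in auto)
      also have "\<dots> = (\<bar>A\<bar> * ((2 * L + I) / 2)) * exp (e * Im z)" using L by simp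
      also have "\<dots> \<le> max (exp (C1 * (1 + 3 * R)\<^sup>2)) (\<bar>A\<bar> * ((2 * L + I) / 2)) * exp (e * Im z)"
        by (rule mult_right_mono) auto
      finally show ?thesis .
    qed
    then show ?thesis by blast
  qed
  have "cmod (\<Phi> (Complex 0 y)) \<le> (N + I) / 2"
    by (rule Phragmen_Lindelof_half_plane[OF C1 \<Phi>_cont \<Phi>_hol \<Phi>_growth \<Phi>_cone \<Phi>_real]) (use y in auto)
  moreover have "\<Phi> (Complex 0 y) = of_real I"
  proof -
    have "F (Complex 0 y + of_real s) * g s = of_real ((cmod (g s))\<^sup>2)" for s
    proof -
      have "Complex 0 y + of_real s = Complex s y" by (simp add: complex_eq_iff)
      then show ?thesis by (simp add: g_def complex_norm_square del: of_real_power)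
    qed
    then have "\<Phi> (Complex 0 y) = integral {-L..L} (\<lambda>s. of_real ((cmod (g s))\<^sup>2))" by (simp add: \<Phi>_def)
    also have "\<dots> = of_real I"
      unfolding I_def by (rule integral_unique, rule has_integral_of_real, rule integrable_integral)
        (intro integrable_continuous_interval continuous_intros contg)
    finally show ?thesis .
  qed
  ultimately have "I \<le> N" using I0 by simp
  then show "integral {-L..L} (\<lambda>x. (cmod (F (Complex x y)))\<^sup>2) \<le> N" by (simp add: I_def g_def)
qed

section \<open>Harnack's inequality in the upper half-plane\<close>

text \<open>
  The Cayley transforms of the half-plane and of the right half-plane turn \<open>p\<close> into a
  self-map of the disc fixing \<open>0\<close>, and Schwarz's lemma gives the estimate. When
  \<open>z\<close> tends to infinity in a cone around the imaginary axis, the factor on the right is at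
  most a multiple of \<open>Im z / Im z0\<close>; so a function that is small relative to the height at
  the single point \<open>z0\<close> remains so far out in the cone.
\<close>

lemma Harnack_half_plane:
  assumes hol: "p holomorphic_on upper_half_plane" and pos: "\<And>z. 0 < Im z \<Longrightarrow> 0 < Re (p z)"
    and z0: "0 < Im z0" and z: "0 < Im z"
  shows "Re (p z) \<le> Re (p z0) * (cmod (z - cnj z0))\<^sup>2 / (Im z * Im z0)"
proof -
  \<comment> \<open>The identity behind the Cayley transform of the right half-plane.\<close>
  have pyth: "(cmod (u + cnj v))\<^sup>2 = (cmod (u - v))\<^sup>2 + 4 * Re u * Re v" for u v
    unfolding cmod_power2 by (simp add: power2_eq_square algebra_simps)
  define T where "T = (\<lambda>w. (z0 - cnj z0 * w) / (1 - w))"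
  have T: "0 < Im (T w)" if w: "cmod w < 1" for w
  proof -
    have nw: "1 - w \<noteq> 0" using w by auto
    have "T w = (z0 - cnj z0 * w) * cnj (1 - w) / of_real ((cmod (1 - w))\<^sup>2)"
      unfolding T_def complex_norm_square using nw by (simp del: complex_cnj_diff)
    then have "Im (T w) = Im ((z0 - cnj z0 * w) * cnj (1 - w)) / (cmod (1 - w))\<^sup>2"
      by (simp only: Im_divide_of_real)
    also have "Im ((z0 - cnj z0 * w) * cnj (1 - w)) = Im z0 * (1 - (cmod w)\<^sup>2)"
      unfolding cmod_power2 by (simp add: power2_eq_square algebra_simps)
    also have "\<dots> / (cmod (1 - w))\<^sup>2 > 0"
    proof (intro divide_pos_pos mult_pos_pos z0)
      show "0 < 1 - (cmod w)\<^sup>2" using w by (simp add: abs_square_less_1)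
      show "0 < (cmod (1 - w))\<^sup>2" using w by auto
    qed
    finally show ?thesis .
  qed
  define q where "q = (\<lambda>w. (p (T w) - p z0) / (p (T w) + cnj (p z0)))"
  define w where "w = (z - z0) / (z - cnj z0)"
  have ne: "z - cnj z0 \<noteq> 0" using z z0 by (auto simp: complex_eq_iff)
  have ne0: "z0 - cnj z0 \<noteq> 0" using z0 by (auto simp: complex_eq_iff)
  have "1 - w = (z0 - cnj z0) / (z - cnj z0)" "z0 - cnj z0 * w = z * (z0 - cnj z0) / (z - cnj z0)"
    unfolding w_def using ne by (simp_all add: field_simps)
  then have Tw: "T w = z" using ne ne0 by (simp add: T_def)
  have "(cmod (z - cnj z0))\<^sup>2 = (cmod (z - z0))\<^sup>2 + 4 * Im z * Im z0"
    unfolding cmod_power2 by (simp add: power2_eq_square algebra_simps)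
  then have rho: "1 - (cmod w)\<^sup>2 = 4 * Im z * Im z0 / (cmod (z - cnj z0))\<^sup>2"
  proof -
    have "1 - (cmod w)\<^sup>2 = ((cmod (z - cnj z0))\<^sup>2 - (cmod (z - z0))\<^sup>2) / (cmod (z - cnj z0))\<^sup>2"
      unfolding w_def norm_divide power_divide using ne by (simp add: diff_divide_distrib del: complex_cnj_diff)
    then show ?thesis using \<open>(cmod (z - cnj z0))\<^sup>2 = _\<close> by simp
  qed
  moreover have "4 * Im z * Im z0 / (cmod (z - cnj z0))\<^sup>2 > 0" using z z0 ne by simp
  ultimately have "(cmod w)\<^sup>2 < 1" by linarith
  then have w1: "cmod w < 1" by (simp add: abs_square_less_1)
  have qlt: "cmod (q v) < 1" if "cmod v < 1" for v
  proof -
    have "0 < 4 * Re (p (T v)) * Re (p z0)" using pos[OF T[OF that]] pos[OF z0] by simp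
    then have "(cmod (p (T v) - p z0))\<^sup>2 < (cmod (p (T v) + cnj (p z0)))\<^sup>2" unfolding pyth by simp
    then have "cmod (p (T v) - p z0) < cmod (p (T v) + cnj (p z0))" by (rule power_less_imp_less_base) simp
    then show ?thesis unfolding q_def norm_divide by (metis divide_less_eq_1_pos norm_ge_zero order_le_less_trans)
  qed
  have "(p \<circ> T) holomorphic_on ball 0 1"
  proof (rule holomorphic_on_compose_gen[OF _ hol])
    show "T holomorphic_on ball 0 1" unfolding T_def by (intro holomorphic_intros) auto
  qed (use T in auto)
  then have hpT: "(\<lambda>v. p (T v)) holomorphic_on ball 0 1" by (simp add: o_def)
  have "q holomorphic_on ball 0 1" unfolding q_def
  proof (intro holomorphic_intros hpT)
    fix v :: complex assume "v \<in> ball 0 1"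
    then have "0 < Re (p (T v) + cnj (p z0))" using pos[OF T[of v]] pos[OF z0] by simp
    then show "p (T v) + cnj (p z0) \<noteq> 0" by force
  qed
  moreover have "q 0 = 0" by (simp add: q_def T_def)
  ultimately have "cmod (q w) \<le> cmod w" using qlt w1 by (rule Schwarz_Lemma(1))
  then have "cmod (p z - p z0) / cmod (p z + cnj (p z0)) \<le> cmod w" by (simp add: q_def Tw norm_divide)
  moreover have re: "0 < Re (p z + cnj (p z0))" using pos[OF z] pos[OF z0] by simp
  then have "0 < cmod (p z + cnj (p z0))" by (metis complex_Re_le_cmod order_less_le_trans)
  ultimately have "cmod (p z - p z0) \<le> cmod w * cmod (p z + cnj (p z0))" by (simp add: divide_le_eq)
  then have "(cmod (p z - p z0))\<^sup>2 \<le> (cmod w)\<^sup>2 * (cmod (p z + cnj (p z0)))\<^sup>2"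
    by (metis norm_ge_zero power_mono power_mult_distrib)
  then have "(1 - (cmod w)\<^sup>2) * (cmod (p z + cnj (p z0)))\<^sup>2 \<le> 4 * Re (p z) * Re (p z0)"
    using pyth[of "p z" "p z0"] by (simp add: algebra_simps)
  moreover have "(Re (p z))\<^sup>2 \<le> (cmod (p z + cnj (p z0)))\<^sup>2"
    by (rule power_mono) (use pos[OF z] pos[OF z0] complex_Re_le_cmod[of "p z + cnj (p z0)"] in auto)
  then have "(1 - (cmod w)\<^sup>2) * (Re (p z))\<^sup>2 \<le> (1 - (cmod w)\<^sup>2) * (cmod (p z + cnj (p z0)))\<^sup>2"
    by (rule mult_left_mono) (use w1 in \<open>simp add: abs_square_le_1\<close>)
  ultimately have "(1 - (cmod w)\<^sup>2) * (Re (p z))\<^sup>2 \<le> 4 * Re (p z) * Re (p z0)" by linarith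
  then have "((1 - (cmod w)\<^sup>2) * Re (p z)) * Re (p z) \<le> (4 * Re (p z0)) * Re (p z)"
    by (simp add: power2_eq_square mult_ac)
  then have "(1 - (cmod w)\<^sup>2) * Re (p z) \<le> 4 * Re (p z0)"
    using pos[OF z] by (rule mult_right_le_imp_le)
  moreover have "R \<le> R0 * Y / (s * t)" if "0 < Y" "0 < s" "0 < t" "4 * s * t / Y * R \<le> 4 * R0" for Y s t R R0 :: real
    using that by (simp add: field_simps)
  moreover have "0 < (cmod (z - cnj z0))\<^sup>2" using ne by simp
  ultimately show ?thesis using z z0 unfolding rho by blast
qed

lemma Harnack_log_modulus:
  assumes hol: "W holomorphic_on upper_half_plane" and ge: "\<And>z. 0 < Im z \<Longrightarrow> 1 \<le> cmod (W z)"
    and z0: "0 < Im z0" and z: "0 < Im z"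
  shows "ln (cmod (W z)) \<le> ln (cmod (W z0)) * (cmod (z - cnj z0))\<^sup>2 / (Im z * Im z0)"
proof -
  have nz: "W z \<noteq> 0" if "0 < Im z" for z using ge[OF that] by auto
  obtain p where p: "p holomorphic_on upper_half_plane" "\<And>z. z \<in> upper_half_plane \<Longrightarrow> exp (p z) = W z"
    by (rule holomorphic_logarithm_exists[of upper_half_plane W \<i>]) (use hol nz in auto)
  have Rep: "Re (p v) = ln (cmod (W v))" if "0 < Im v" for v
    using p(2)[of v] that by (metis norm_exp_eq_Re ln_exp upper_half_plane_props(3))
  define R where "R = (cmod (z - cnj z0))\<^sup>2 / (Im z * Im z0)"
  have le: "ln (cmod (W z)) + e \<le> (ln (cmod (W z0)) + e) * R" if e: "e > 0" for e
  proof -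
    have "Re (p z + of_real e) \<le> Re (p z0 + of_real e) * (cmod (z - cnj z0))\<^sup>2 / (Im z * Im z0)"
    proof (rule Harnack_half_plane[OF _ _ z0 z])
      show "(\<lambda>z. p z + of_real e) holomorphic_on upper_half_plane" by (intro holomorphic_intros p(1))
      show "0 < Re (p v + of_real e)" if "0 < Im v" for v
        using Rep[OF that] ge[OF that] e by (simp add: add_nonneg_pos)
    qed
    then show ?thesis using Rep[OF z] Rep[OF z0] by (simp add: R_def)
  qed
  have "((\<lambda>e. (ln (cmod (W z0)) + e) * R - e) \<longlongrightarrow> (ln (cmod (W z0)) + 0) * R - 0) (at_right 0)"
    by (intro tendsto_intros)
  then have "ln (cmod (W z)) \<le> (ln (cmod (W z0)) + 0) * R - 0"
    by (rule tendsto_lowerbound) (use le in \<open>auto simp: eventually_at_filter le_diff_eq intro!: always_eventually\<close>)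
  then show ?thesis by (simp add: R_def)
qed

section \<open>Growth of entire functions across the real axis\<close>

lemma Re_inverse_power3_ge:
  assumes le: "\<bar>Im z\<bar> \<le> Re z / 3" and pos: "0 < Re z"
  shows "1 / (3 * (Re z) ^ 3) \<le> Re (1 / z ^ 3)"
proof -
  define x where "x = Re z"
  have x: "0 < x" using pos by (simp add: x_def)
  have z0: "z \<noteq> 0" using pos by auto
  have "(Im z)\<^sup>2 \<le> (x / 3)\<^sup>2" using le pos by (simp add: x_def abs_le_square_iff[symmetric])
  then have "(cmod z)\<^sup>2 \<le> (10 / 9) * x\<^sup>2" unfolding cmod_power2 x_def power_divide by simp
  then have "((cmod z)\<^sup>2) ^ 3 \<le> ((10 / 9) * x\<^sup>2) ^ 3" by (rule power_mono) simp
  also have "\<dots> = (1000 / 729) * (x ^ 3 * x ^ 3)" by (simp add: power_mult_distrib power2_eq_square power3_eq_cube)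
  also have "\<dots> \<le> (3 / 2) * (x ^ 3 * x ^ 3)" using x by simp
  finally have c: "(cmod (z ^ 3))\<^sup>2 \<le> (3 / 2) * (x ^ 3 * x ^ 3)"
    by (simp add: norm_power power_mult[symmetric] mult.commute)
  have "0 \<le> (Re z) ^ 3 / 2" using pos by simp
  then have r: "0 \<le> Re (z ^ 3)" using Re_power3_ge[OF le] by linarith
  have "1 / (3 * x ^ 3) = (x ^ 3 / 2) / ((3 / 2) * (x ^ 3 * x ^ 3))" using x by (simp add: field_simps)
  also have "\<dots> \<le> Re (z ^ 3) / (cmod (z ^ 3))\<^sup>2"
    using Re_power3_ge[OF le] r c z0 x by (intro frac_le) (auto simp: x_def)
  also have "\<dots> = Re (1 / z ^ 3)" by (simp add: Re_divide cmod_power2)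
  finally show ?thesis by (simp add: x_def)
qed

text \<open>
  The bound is singular only on the real axis, so the maximum principle is applied on a rhombus
  around the segment from \<open>-3\<close> to \<open>3\<close> whose sides meet the axis only at these two points.
  On a side, at distance of order \<open>x\<close> from the vertex, \<open>log |k|\<close> is at most a multiple
  of \<open>A / x^2\<close>. The real part of \<open>1 / (3 - w) ^ 3\<close> and \<open>1 / (3 + w) ^ 3\<close>
  is positive on the rhombus and of order \<open>1 / x^3\<close> near the vertices, so that the exponential
  of a negative multiple of it compensates the singularity.
\<close>

lemma entire_bound_across_segment:
  assumes hol: "k holomorphic_on UNIV" and A: "0 < A"
    and le: "\<And>w. \<bar>Re w\<bar> \<le> 3 \<Longrightarrow> Im w \<noteq> 0 \<Longrightarrow> \<bar>Im w\<bar> \<le> 1 \<Longrightarrow> cmod (k w) \<le> exp (A / (Im w)\<^sup>2)"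
    and z: "Re z = 0" "\<bar>Im z\<bar> \<le> 1 / 2"
  shows "cmod (k z) \<le> exp (6 * A)"
proof -
  \<comment> \<open>On a side of the rhombus \<open>|Im w| = x / 3\<close>, the exponent of the bound is \<open>9 A / x^2\<close>, and
    the multiplier contributes at most \<open>- B / (3 x^3) \<le> - B / (9 x^2)\<close> since \<open>x \<le> 3\<close>.\<close>
  define B where "B = 81 * A"
  have B: "0 < B" using A by (simp add: B_def)
  define g where "g = (\<lambda>w. k w * exp (- of_real B * (1 / (3 - w) ^ 3 + 1 / (3 + w) ^ 3)))"
  have cmg: "cmod (g w) = cmod (k w) * exp (- B * (Re (1 / (3 - w) ^ 3) + Re (1 / (3 + w) ^ 3)))" for w
    by (simp add: g_def norm_mult)
  have contk: "continuous_on X k" for X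
    using holomorphic_on_imp_continuous_on[OF hol] continuous_on_subset by blast
  obtain M where M: "\<And>w. cmod w \<le> 4 \<Longrightarrow> cmod (k w) \<le> M"
  proof -
    have "compact (k ` cball 0 4)" by (intro compact_continuous_image contk) simp
    then obtain M where M: "\<And>w. w \<in> cball 0 4 \<Longrightarrow> cmod (k w) \<le> M"
      by (meson bounded_iff compact_imp_bounded imageI)
    show ?thesis by (rule that[of M], rule M) simp
  qed
  have M0: "0 \<le> M" using M[of 0] norm_ge_zero[of "k 0"] by (simp; linarith)
  \<comment> \<open>The corners of the rhombus are cut off at distance \<open>d\<close>, where the multiplier outweighs the
    maximum \<open>M\<close> of \<open>|k|\<close>.\<close>
  have "((\<lambda>d::real. M * exp (- B * (1 / (3 * d ^ 3)))) \<longlongrightarrow> 0) (at_right 0)"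
    using B by real_asymp
  then have "eventually (\<lambda>d::real. M * exp (- B * (1 / (3 * d ^ 3))) < 1) (at_right 0)"
    by (rule order_tendstoD) simp
  moreover have "eventually (\<lambda>d::real. d \<in> {0<..<1}) (at_right 0)"
    by (rule eventually_at_right_real) simp
  ultimately have "eventually (\<lambda>d::real. M * exp (- B * (1 / (3 * d ^ 3))) < 1 \<and> d \<in> {0<..<1}) (at_right 0)"
    by (rule eventually_conj)
  then obtain d where d: "M * exp (- B * (1 / (3 * d ^ 3))) < 1" "0 < d" "d < 1"
    by (metis (mono_tags, lifting) eventually_happens' greaterThanLessThan_iff trivial_limit_at_right_real)
  define T where "T = {w. \<bar>Re w\<bar> \<le> 3 - d \<and> 3 * \<bar>Im w\<bar> \<le> 3 - \<bar>Re w\<bar>}"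
  define T0 where "T0 = {w. \<bar>Re w\<bar> < 3 - d \<and> 3 * \<bar>Im w\<bar> < 3 - \<bar>Re w\<bar>}"
  define V where "V = {w. \<bar>Re w\<bar> < 3}"
  have clT: "closed T" unfolding T_def
    by (intro closed_Collect_conj closed_Collect_le continuous_intros)
  have opT: "open T0" unfolding T0_def
    by (intro open_Collect_conj open_Collect_less continuous_intros)
  have opV: "open V" unfolding V_def by (intro open_Collect_less continuous_intros)
  have cT: "cmod w \<le> 4" if "w \<in> T" for w
    using that cmod_le[of w] d(2) unfolding T_def by auto
  have TV: "T \<subseteq> V" using d by (auto simp: T_def V_def)
  have nz: "3 - w \<noteq> 0" "3 + w \<noteq> 0" if "w \<in> V" for w
    using that by (auto simp: V_def complex_eq_iff)
  have hg: "g holomorphic_on V" unfolding g_def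
    by (intro holomorphic_intros holomorphic_on_subset[OF hol]) (use nz in auto)
  have "cmod (g z) \<le> 1"
  proof (rule maximum_modulus_compact[where S = T and U = T0 and V = V and f = g])
    show "compact T" using clT cT by (meson boundedI compact_eq_bounded_closed)
    show "T0 \<subseteq> T" by (auto simp: T_def T0_def)
    show "interior T \<subseteq> V" using TV interior_subset by blast
    show "continuous_on T g" by (rule continuous_on_subset[OF holomorphic_on_imp_continuous_on[OF hg] TV])
    show "z \<in> T" using z d by (auto simp: T_def)
    show "cmod (g w) \<le> 1" if w: "w \<in> T - T0" for w
    proof -
      define x where "x = 3 - \<bar>Re w\<bar>"
      have x: "0 < x" "x \<le> 3" "d \<le> x" "3 * \<bar>Im w\<bar> \<le> x" using w d by (auto simp: T_def x_def)
      have "1 / (3 * x ^ 3) \<le> Re (1 / (3 - w) ^ 3) + Re (1 / (3 + w) ^ 3)"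
      proof -
        have l: "1 / (3 * (Re (3 - w)) ^ 3) \<le> Re (1 / (3 - w) ^ 3)"
          by (rule Re_inverse_power3_ge) (use x in \<open>auto simp: x_def\<close>)
        have r: "1 / (3 * (Re (3 + w)) ^ 3) \<le> Re (1 / (3 + w) ^ 3)"
          by (rule Re_inverse_power3_ge) (use x in \<open>auto simp: x_def\<close>)
        have "0 \<le> 1 / (3 * (Re (3 - w)) ^ 3)" "0 \<le> 1 / (3 * (Re (3 + w)) ^ 3)"
          using x by (auto simp: x_def)
        with l r have nn: "0 \<le> Re (1 / (3 - w) ^ 3)" "0 \<le> Re (1 / (3 + w) ^ 3)" by linarith+
        have "Re (3 - w) = x \<or> Re (3 + w) = x" by (cases "0 \<le> Re w") (auto simp: x_def)
        then show ?thesis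
        proof
          assume "Re (3 - w) = x"
          then show ?thesis using l nn(2) by (metis add_increasing2)
        next
          assume "Re (3 + w) = x"
          then show ?thesis using r nn(1) by (metis add_increasing)
        qed
      qed
      then have "B * (1 / (3 * x ^ 3)) \<le> B * (Re (1 / (3 - w) ^ 3) + Re (1 / (3 + w) ^ 3))"
        by (rule mult_left_mono[OF _ less_imp_le[OF B]])
      then have gle: "cmod (g w) \<le> cmod (k w) * exp (- B * (1 / (3 * x ^ 3)))"
        unfolding cmg by (intro mult_left_mono) simp_all
      consider "\<bar>Re w\<bar> = 3 - d" | "3 * \<bar>Im w\<bar> = x" using w by (force simp: T_def T0_def x_def)
      then show ?thesis
      proof cases
        case 1
        then have "x = d" by (simp add: x_def)
        have "cmod (k w) \<le> M" using w by (intro M cT) simp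
        then have "cmod (k w) * exp (- B * (1 / (3 * d ^ 3))) \<le> M * exp (- B * (1 / (3 * d ^ 3)))"
          by (rule mult_right_mono) simp
        then have "cmod (g w) \<le> M * exp (- B * (1 / (3 * d ^ 3)))"
          using gle unfolding \<open>x = d\<close> by linarith
        then show ?thesis using d(1) by linarith
      next
        case 2
        then have "\<bar>Im w\<bar> = x / 3" by simp
        then have "(Im w)\<^sup>2 = (x / 3)\<^sup>2" by (metis power2_abs)
        then have imw: "A / (Im w)\<^sup>2 = B / (9 * x\<^sup>2)" by (simp only:) (simp add: B_def power_divide)
        have "cmod (k w) \<le> exp (A / (Im w)\<^sup>2)"
          by (rule le) (use x 2 w d in \<open>auto simp: T_def\<close>)
        then have "cmod (k w) * exp (- B * (1 / (3 * x ^ 3))) \<le> exp (B / (9 * x\<^sup>2)) * exp (- B * (1 / (3 * x ^ 3)))"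
          unfolding imw by (rule mult_right_mono) simp
        then have "cmod (g w) \<le> exp (B / (9 * x\<^sup>2)) * exp (- B * (1 / (3 * x ^ 3)))"
          using gle by linarith
        also have "\<dots> = exp (B / (9 * x\<^sup>2) - B * (1 / (3 * x ^ 3)))" by (simp add: exp_add[symmetric])
        also have "\<dots> \<le> 1"
        proof -
          have "B / (9 * x\<^sup>2) \<le> B * (1 / (3 * x ^ 3))"
          proof -
            have "x ^ 3 \<le> 3 * x\<^sup>2" using mult_right_mono[OF x(2), of "x\<^sup>2"] by (simp add: power3_eq_cube power2_eq_square)
            then have "B / (9 * x\<^sup>2) \<le> B / (3 * x ^ 3)" using x B by (intro divide_left_mono) auto
            then show ?thesis by simp
          qed
          then show ?thesis by simp
        qed
        finally show ?thesis .
      qed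
    qed
  qed (use opT opV hg in auto)
  moreover have "Re (1 / (3 - z) ^ 3) + Re (1 / (3 + z) ^ 3) \<le> 2 / 27"
  proof -
    have "Re (1 / u ^ 3) \<le> 1 / 27" if "Re u = 3" for u
    proof -
      have "3 \<le> cmod u" using that complex_Re_le_cmod[of u] by simp
      then have "3 ^ 3 \<le> cmod u ^ 3" by (intro power_mono) auto
      then have "1 / cmod u ^ 3 \<le> 1 / 3 ^ 3" by (rule divide_left_mono) (use \<open>3 \<le> cmod u\<close> in auto)
      then have "cmod (1 / u ^ 3) \<le> 1 / 27" by (simp add: norm_divide norm_power)
      then show ?thesis by (rule order_trans[OF complex_Re_le_cmod])
    qed
    from this[of "3 - z"] this[of "3 + z"] show ?thesis using z by simp
  qed
  then have "B * (Re (1 / (3 - z) ^ 3) + Re (1 / (3 + z) ^ 3)) \<le> B * (2 / 27)"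
    by (rule mult_left_mono[OF _ less_imp_le[OF B]])
  then have "B * (Re (1 / (3 - z) ^ 3) + Re (1 / (3 + z) ^ 3)) \<le> 6 * A"
    by (simp add: B_def)
  then have "exp (- (6 * A)) \<le> exp (- B * (Re (1 / (3 - z) ^ 3) + Re (1 / (3 + z) ^ 3)))" by simp
  then have "cmod (k z) * exp (- (6 * A)) \<le> cmod (g z)" unfolding cmg by (intro mult_left_mono) auto
  ultimately have "cmod (k z) * exp (- (6 * A)) \<le> 1" by linarith
  then show ?thesis by (simp add: exp_minus field_simps)
qed

lemma entire_bound_across_real_axis:
  assumes hol: "k holomorphic_on UNIV" and K: "0 < K"
    and le: "\<And>w. Im w \<noteq> 0 \<Longrightarrow> cmod (k w) \<le> exp (K * (1 + cmod w)\<^sup>2 / (min 1 \<bar>Im w\<bar>)\<^sup>2)"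
  shows "cmod (k z) \<le> exp (150 * K * (1 + cmod z)\<^sup>2)"
proof (cases "\<bar>Im z\<bar> \<le> 1 / 2")
  case False
  then have "(1 / 2)\<^sup>2 \<le> (min 1 \<bar>Im z\<bar>)\<^sup>2" by (intro power_mono) auto
  then have "K * (1 + cmod z)\<^sup>2 / (min 1 \<bar>Im z\<bar>)\<^sup>2 \<le> K * (1 + cmod z)\<^sup>2 / (1 / 2)\<^sup>2"
    using K by (intro divide_left_mono) (auto simp: power2_eq_square False)
  also have "\<dots> = 4 * (K * (1 + cmod z)\<^sup>2)" by (simp add: power_divide)
  also have "\<dots> \<le> 150 * (K * (1 + cmod z)\<^sup>2)" using K by (intro mult_right_mono) auto
  also have "\<dots> = 150 * K * (1 + cmod z)\<^sup>2" by simp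
  finally have "exp (K * (1 + cmod z)\<^sup>2 / (min 1 \<bar>Im z\<bar>)\<^sup>2) \<le> exp (150 * K * (1 + cmod z)\<^sup>2)" by simp
  moreover have "Im z \<noteq> 0" using False by auto
  ultimately show ?thesis using le[of z] by linarith
next
  case True
  define x where "x = complex_of_real (Re z)"
  define A where "A = 25 * K * (1 + cmod z)\<^sup>2"
  have "0 < 1 + cmod z" by (simp add: add_pos_nonneg)
  then have "A > 0" using K by (simp add: A_def)
  have "cmod (k (x + (z - x))) \<le> exp (6 * A)"
  proof (rule entire_bound_across_segment[where k = "\<lambda>w. k (x + w)"])
    have "(k \<circ> (\<lambda>w. x + w)) holomorphic_on UNIV"
      by (rule holomorphic_on_compose_gen[OF _ hol]) (auto intro!: holomorphic_intros)
    then show "(\<lambda>w. k (x + w)) holomorphic_on UNIV" by (simp add: o_def)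
    fix w assume w: "\<bar>Re w\<bar> \<le> 3" "Im w \<noteq> 0" "\<bar>Im w\<bar> \<le> 1"
    have "cmod x \<le> cmod z" by (simp add: x_def abs_Re_le_cmod)
    then have "1 + cmod (x + w) \<le> 5 * (1 + cmod z)"
      using norm_triangle_ineq[of x w] cmod_le[of w] w(1,3) norm_ge_zero[of z] by argo
    then have "(1 + cmod (x + w))\<^sup>2 \<le> (5 * (1 + cmod z))\<^sup>2" by (intro power_mono) auto
    also have "\<dots> = 25 * (1 + cmod z)\<^sup>2" unfolding power_mult_distrib by simp
    finally have "K * (1 + cmod (x + w))\<^sup>2 \<le> A" using K by (simp add: A_def)
    then have "K * (1 + cmod (x + w))\<^sup>2 / (Im w)\<^sup>2 \<le> A / (Im w)\<^sup>2" by (rule divide_right_mono) simp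
    moreover have "cmod (k (x + w)) \<le> exp (K * (1 + cmod (x + w))\<^sup>2 / (Im w)\<^sup>2)"
      using le[of "x + w"] w by (simp add: x_def min_absorb2)
    ultimately show "cmod (k (x + w)) \<le> exp (A / (Im w)\<^sup>2)" by (meson exp_le_cancel_iff order_trans)
  qed (use True \<open>A > 0\<close> in \<open>auto simp: x_def\<close>)
  then show ?thesis by (simp add: A_def mult.assoc)
qed

section \<open>Functions whose reciprocal is a Hardy function up to a linear factor\<close>

text \<open>
  The information on \<open>E\<close> that regularity provides; everything that follows about the growth
  of \<open>E\<close> uses only this.
\<close>

locale reciprocal_hardy =
  fixes E :: "complex \<Rightarrow> complex" and \<alpha> :: complex and S :: real
  assumes entire: "E holomorphic_on UNIV"
    and nonzero: "\<And>z. 0 < Im z \<Longrightarrow> E z \<noteq> 0"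
    and \<alpha>: "Im \<alpha> < 0" and S: "0 < S"
    and energy: "\<And>y. y > 0 \<Longrightarrow> line_energy_le (\<lambda>z. 1 / ((z - \<alpha>) * E z)) y S"
begin

lemma minus_\<alpha>: "\<bar>Im \<alpha>\<bar> \<le> cmod (z - \<alpha>)" "z - \<alpha> \<noteq> 0" if "0 \<le> Im z"
proof -
  show "\<bar>Im \<alpha>\<bar> \<le> cmod (z - \<alpha>)" using abs_Im_le_cmod[of "z - \<alpha>"] \<alpha> that by simp
  then show "z - \<alpha> \<noteq> 0" using \<alpha> by auto
qed

lemma cont_E: "continuous_on A E"
  by (rule continuous_on_subset[OF holomorphic_on_imp_continuous_on[OF entire]]) simp

lemma holo_E [holomorphic_intros]: "E holomorphic_on A"
  by (rule holomorphic_on_subset[OF entire]) simp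

lemma lower_bound:
  assumes "0 < Im z"
  shows "1 \<le> 3 * S / Im z * (cmod ((z - \<alpha>) * E z))\<^sup>2"
proof -
  have "(\<lambda>z. 1 / ((z - \<alpha>) * E z)) holomorphic_on upper_half_plane"
    by (intro holomorphic_intros) (use nonzero minus_\<alpha> in \<open>auto simp: less_imp_le\<close>)
  then have "(cmod (1 / ((z - \<alpha>) * E z)))\<^sup>2 \<le> 3 * S / Im z"
    by (rule hardy_pointwise_bound) (use S energy assms in auto)
  moreover have "0 < (cmod ((z - \<alpha>) * E z))\<^sup>2" using nonzero[OF assms] minus_\<alpha>(2)[of z] assms by simp
  ultimately show ?thesis unfolding norm_divide power_divide by (simp add: divide_le_eq)
qed

text \<open>
  A real zero would make \<open>|E|\<close> of order \<open>y\<close> at height \<open>y\<close> above it, whereas the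
  lower bound is of order \<open>sqrt y\<close>.
\<close>

lemma nonzero_closed:
  assumes "0 \<le> Im z" shows "E z \<noteq> 0"
proof (cases "Im z = 0")
  case True
  show ?thesis
  proof
    assume E0: "E z = 0"
    have "(E has_field_derivative deriv E z) (at z)" by (rule holomorphic_derivI[OF entire]) auto
    then obtain g where g: "\<forall>w. E w - E z = g w * (w - z)" "isCont g z"
      unfolding CARAT_DERIV by blast
    define h where "h = (\<lambda>y::real. 3 * S * y * (cmod ((z + \<i> * of_real y - \<alpha>) * g (z + \<i> * of_real y)))\<^sup>2)"
    have ev: "1 \<le> h y" if y: "y > 0" for y
    proof -
      let ?w = "z + \<i> * of_real y"
      have "E ?w = g ?w * (\<i> * of_real y)" using g(1)[rule_format, of ?w] E0 by simp
      then have "(cmod ((?w - \<alpha>) * E ?w))\<^sup>2 = (cmod ((?w - \<alpha>) * g ?w))\<^sup>2 * y\<^sup>2"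
        by (simp add: norm_mult power_mult_distrib)
      then show ?thesis using lower_bound[of ?w] True y
        by (simp add: h_def power2_eq_square mult_ac)
    qed
    have "((\<lambda>y. z + \<i> * of_real y) \<longlongrightarrow> z + \<i> * of_real 0) (at_right 0)" by (intro tendsto_intros)
    then have "((\<lambda>y. g (z + \<i> * of_real y)) \<longlongrightarrow> g z) (at_right 0)"
      using isCont_tendsto_compose[OF g(2)] by simp
    then have "(h \<longlongrightarrow> 3 * S * 0 * (cmod ((z + \<i> * of_real 0 - \<alpha>) * g z))\<^sup>2) (at_right 0)"
      unfolding h_def by (intro tendsto_intros)
    then have "1 \<le> 3 * S * 0 * (cmod ((z + \<i> * of_real 0 - \<alpha>) * g z))\<^sup>2"
      by (rule tendsto_lowerbound) (use ev in \<open>auto simp: eventually_at_filter intro!: always_eventually\<close>)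
    then show False by simp
  qed
qed (use assms nonzero in auto)

lemma shifted_ge_one:
  assumes h: "0 < h" and z: "0 < Im z"
  shows "1 \<le> cmod (of_real (sqrt (3 * S / h)) * ((z + \<i> * of_real h - \<alpha>) * E (z + \<i> * of_real h)))"
proof -
  let ?w = "z + \<i> * of_real h"
  have "1 \<le> 3 * S / Im ?w * (cmod ((?w - \<alpha>) * E ?w))\<^sup>2" by (rule lower_bound) (use h z in simp)
  also have "\<dots> \<le> 3 * S / h * (cmod ((?w - \<alpha>) * E ?w))\<^sup>2"
    by (intro mult_right_mono divide_left_mono) (use h z S in auto)
  also have "\<dots> = (cmod (of_real (sqrt (3 * S / h)) * ((?w - \<alpha>) * E ?w)))\<^sup>2"
  proof -
    have "(cmod (of_real (sqrt (3 * S / h)) :: complex))\<^sup>2 = 3 * S / h" using h S by (simp only: norm_of_real) simp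
    then show ?thesis unfolding norm_mult power_mult_distrib by simp
  qed
  finally show ?thesis by (metis norm_ge_zero one_power2 power2_le_imp_le)
qed

lemma shifted_holomorphic:
  "(\<lambda>z. of_real s * ((z + \<i> * of_real h - \<alpha>) * E (z + \<i> * of_real h))) holomorphic_on A"
proof -
  have "(E \<circ> (\<lambda>z. z + \<i> * of_real h)) holomorphic_on A"
    by (rule holomorphic_on_compose_gen[OF _ entire]) (auto intro!: holomorphic_intros)
  then show ?thesis unfolding o_def by (intro holomorphic_intros)
qed

text \<open>
  Shifted upwards by \<open>h\<close> and suitably normalised, \<open>(z - \<alpha>) E\<close> has modulus at least
  \<open>1\<close> on the half-plane, so Harnack's inequality with the base point \<open>i\<close> applies. The
  normalisation costs a factor \<open>1 / sqrt h\<close>; the choice of \<open>h\<close> as half the height of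
  \<open>z\<close> (at most \<open>1/2\<close>) balances this against the distance of \<open>z\<close> from the shifted
  boundary. The square root in the conclusion cancels the one in the pointwise bound
  for Hardy functions.
\<close>

lemma E_upper_bound:
  obtains B D where "0 < B" "0 < D"
    "\<And>z. 0 < Im z \<Longrightarrow> cmod (E z) \<le> D * sqrt (min 1 (Im z)) * exp (B * (1 + cmod z)\<^sup>2 / (min 1 (Im z))\<^sup>2)"
proof -
  have "compact ((\<lambda>h. (\<i> + \<i> * of_real h - \<alpha>) * E (\<i> + \<i> * of_real h)) ` {0..1::real})"
    by (intro compact_continuous_image continuous_intros continuous_on_compose2[OF cont_E[of UNIV]]) auto
  then obtain M where M: "\<And>h. h \<in> {0..1} \<Longrightarrow> cmod ((\<i> + \<i> * of_real h - \<alpha>) * E (\<i> + \<i> * of_real h)) \<le> M"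
    by (metis (no_types, lifting) bounded_iff compact_imp_bounded imageI)
  have M0: "0 \<le> M" using order_trans[OF norm_ge_zero M[of 0]] by simp
  define B where "B = 4 * (sqrt (3 * S) * M + 1)"
  define D where "D = 1 / (sqrt (3 * S) * \<bar>Im \<alpha>\<bar>)"
  show ?thesis
  proof (rule that[of B D])
    show "0 < B" using M0 S by (auto simp: B_def add_nonneg_pos)
    show "0 < D" unfolding D_def using S \<alpha> by (intro divide_pos_pos mult_pos_pos) auto
    fix z assume z: "0 < Im z"
    define m where "m = min 1 (Im z)"
    define h where "h = m / 2"
    have m: "0 < m" "m \<le> 1" "m \<le> Im z" using z by (auto simp: m_def)
    have h: "0 < h" "h \<le> 1" "h \<le> Im z / 2" "2 * h = m" using m by (auto simp: h_def)
    define W where "W = (\<lambda>z. of_real (sqrt (3 * S / h)) * ((z + \<i> * of_real h - \<alpha>) * E (z + \<i> * of_real h)))"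
    define v where "v = z - \<i> * of_real h"
    have v: "h \<le> Im v" "0 < Im v" using h z by (auto simp: v_def)
    have W1: "1 \<le> cmod (W u)" if "0 < Im u" for u unfolding W_def by (rule shifted_ge_one[OF h(1) that])
    have "ln (cmod (W v)) \<le> ln (cmod (W \<i>)) * (cmod (v - cnj \<i>))\<^sup>2 / (Im v * Im \<i>)"
    proof (rule Harnack_log_modulus[OF _ W1])
      show "W holomorphic_on upper_half_plane" unfolding W_def by (rule shifted_holomorphic)
    qed (use v in auto)
    also have "\<dots> = ln (cmod (W \<i>)) * ((cmod (v + \<i>))\<^sup>2 / Im v)" by simp
    also have "\<dots> \<le> (sqrt (3 * S) * M / h) * ((1 + cmod z)\<^sup>2 / h)"
    proof (intro mult_mono frac_le power_mono)
      have "ln (cmod (W \<i>)) \<le> cmod (W \<i>)" by (rule ln_bound, rule less_le_trans[OF zero_less_one W1]) simp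
      also have "\<dots> = sqrt (3 * S / h) * cmod ((\<i> + \<i> * of_real h - \<alpha>) * E (\<i> + \<i> * of_real h))"
        unfolding W_def norm_mult using S h by simp
      also have "\<dots> \<le> (sqrt (3 * S) / h) * M"
      proof (intro mult_mono M)
        have "h * h \<le> h" using h by (simp add: mult_left_le)
        then have "h \<le> sqrt h" using h by (simp add: real_le_rsqrt power2_eq_square)
        then show "sqrt (3 * S / h) \<le> sqrt (3 * S) / h"
          unfolding real_sqrt_divide using h S by (intro frac_le) auto
      qed (use h S in auto)
      finally show "ln (cmod (W \<i>)) \<le> sqrt (3 * S) * M / h" by simp
      have "v + \<i> = z + \<i> * of_real (1 - h)" by (simp add: v_def algebra_simps)
      then have "cmod (v + \<i>) \<le> cmod z + cmod (\<i> * of_real (1 - h))" by (metis norm_triangle_ineq)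
      also have "cmod (\<i> * of_real (1 - h)) = \<bar>1 - h\<bar>" unfolding norm_mult norm_of_real by simp
      finally show "cmod (v + \<i>) \<le> 1 + cmod z" using h by simp
    qed (use h v M0 S in auto)
    also have "\<dots> = sqrt (3 * S) * M * 4 * ((1 + cmod z)\<^sup>2 / m\<^sup>2)"
      using h(1) by (simp add: h(4)[symmetric] power2_eq_square field_simps)
    also have "\<dots> \<le> B * ((1 + cmod z)\<^sup>2 / m\<^sup>2)"
      by (rule mult_right_mono) (auto simp: B_def)
    finally have "ln (cmod (W v)) \<le> B * (1 + cmod z)\<^sup>2 / m\<^sup>2" by simp
    then have "exp (ln (cmod (W v))) \<le> exp (B * (1 + cmod z)\<^sup>2 / m\<^sup>2)" by simp
    then have Wv: "cmod (W v) \<le> exp (B * (1 + cmod z)\<^sup>2 / m\<^sup>2)"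
      by (subst (asm) exp_ln[OF less_le_trans[OF zero_less_one W1[OF v(2)]]])
    have "cmod (W v) = sqrt (3 * S / h) * (cmod (z - \<alpha>) * cmod (E z))"
      unfolding W_def norm_mult using S h by (simp add: v_def)
    moreover have "sqrt (3 * S / h) * (\<bar>Im \<alpha>\<bar> * cmod (E z)) \<le> sqrt (3 * S / h) * (cmod (z - \<alpha>) * cmod (E z))"
      using minus_\<alpha>(1)[of z] z h S by (intro mult_left_mono mult_right_mono) auto
    ultimately have "sqrt (3 * S / h) * (\<bar>Im \<alpha>\<bar> * cmod (E z)) \<le> cmod (W v)" by simp
    moreover have "sqrt (3 * S / h) * (\<bar>Im \<alpha>\<bar> * cmod (E z)) = cmod (E z) / (D * sqrt h)"
      using S h by (simp add: D_def real_sqrt_divide)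
    moreover have "0 < D * sqrt h" using \<open>0 < D\<close> h by simp
    ultimately have "cmod (E z) \<le> D * sqrt h * cmod (W v)" by (simp add: divide_le_eq mult.commute)
    also have "\<dots> \<le> D * sqrt m * exp (B * (1 + cmod z)\<^sup>2 / m\<^sup>2)"
      using Wv \<open>0 < D\<close> h m by (intro mult_mono) auto
    finally show "cmod (E z) \<le> D * sqrt (min 1 (Im z)) * exp (B * (1 + cmod z)\<^sup>2 / (min 1 (Im z))\<^sup>2)"
      by (simp add: m_def)
  qed
qed

text \<open>
  A function in the de Branges space satisfies the two bounds, the second one through its conjugate
  function. Together with the upper bound for \<open>E\<close> they are singular on the real axis only,
  where the singularity can be removed because \<open>k\<close> is entire.
\<close>

lemma entire_growth:
  assumes hol: "k holomorphic_on UNIV" and C: "0 \<le> C"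
    and up: "\<And>z. 0 < Im z \<Longrightarrow> cmod (k z) \<le> C * cmod (E z) / sqrt (Im z)"
    and down: "\<And>z. Im z < 0 \<Longrightarrow> cmod (k z) \<le> C * cmod (E (cnj z)) / sqrt (- Im z)"
  obtains K where "0 < K" "\<And>z. cmod (k z) \<le> exp (K * (1 + cmod z)\<^sup>2)"
proof -
  obtain B D where BD: "0 < B" "0 < D"
    "\<And>z. 0 < Im z \<Longrightarrow> cmod (E z) \<le> D * sqrt (min 1 (Im z)) * exp (B * (1 + cmod z)\<^sup>2 / (min 1 (Im z))\<^sup>2)"
    by (rule E_upper_bound) blast
  define K where "K = B + C * D"
  have K: "0 < K" using BD C by (simp add: K_def add_pos_nonneg)
  have E_le: "C * cmod (E z) / sqrt (Im z) \<le> exp (K * (1 + cmod z)\<^sup>2 / (min 1 (Im z))\<^sup>2)" if z: "0 < Im z" for z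
  proof -
    define m where "m = min 1 (Im z)"
    have m: "0 < m" "m \<le> 1" "m \<le> Im z" using z by (auto simp: m_def)
    define X where "X = (1 + cmod z)\<^sup>2 / m\<^sup>2"
    have "m \<le> 1 + cmod z" using m(2) norm_ge_zero[of z] by linarith
    then have X: "1 \<le> X" unfolding X_def using m(1) by (simp add: power_mono)
    have "C * cmod (E z) / sqrt (Im z) \<le> C * (D * sqrt m * exp (B * X)) / sqrt (Im z)"
      using BD(3)[OF z] C z by (intro divide_right_mono mult_left_mono) (auto simp: m_def X_def)
    also have "\<dots> = C * D * exp (B * X) * (sqrt m / sqrt (Im z))" by simp
    also have "\<dots> \<le> C * D * exp (B * X) * 1"
      using m z C BD by (intro mult_left_mono) auto
    also have "\<dots> \<le> exp (C * D * X) * exp (B * X)"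
    proof -
      have "C * D \<le> C * D * X" using X C BD mult_left_mono[of 1 X "C * D"] by simp
      also have "\<dots> \<le> exp (C * D * X)" using exp_ge_add_one_self[of "C * D * X"] by linarith
      finally show ?thesis by simp
    qed
    also have "\<dots> = exp (K * (1 + cmod z)\<^sup>2 / m\<^sup>2)"
      by (simp add: K_def X_def exp_add[symmetric] algebra_simps add_divide_distrib)
    finally show ?thesis by (simp add: m_def)
  qed
  have "cmod (k z) \<le> exp (K * (1 + cmod z)\<^sup>2 / (min 1 \<bar>Im z\<bar>)\<^sup>2)" if "Im z \<noteq> 0" for z
  proof (cases "0 < Im z")
    case True
    then show ?thesis using order_trans[OF up[OF True] E_le[OF True]] by simp
  next
    case False
    then have z: "Im z < 0" using that by simp
    then show ?thesis using order_trans[OF down[OF z]] E_le[of "cnj z"] by simp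
  qed
  then have "cmod (k z) \<le> exp (150 * K * (1 + cmod z)\<^sup>2)" for z
    by (rule entire_bound_across_real_axis[OF hol K])
  then show ?thesis using that[of "150 * K"] K by simp
qed

text \<open>
  Let \<open>c\<close> be the infimum of \<open>log |W| / Im z\<close>, where \<open>W\<close> is \<open>(z - \<alpha>) E\<close> shifted
  and normalised to have modulus at least \<open>1\<close>. Then \<open>log |W| - c Im z\<close> is still positive
  harmonic and, relative to the height, as small as desired at one point \<open>z0\<close>; by Harnack's
  inequality it stays so in a whole cone. Thus \<open>log |W|\<close> is \<open>c Im z\<close> up to an arbitrarily
  small multiple of \<open>Im z\<close>, and \<open>c \<ge> 0\<close> with \<open>a \<le> 1\<close> decides the comparison of
  \<open>E(a z + \<beta>)\<close> with \<open>E(z)\<close>.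
\<close>

lemma E_ratio_bound:
  assumes a: "0 < a" "a \<le> 1" and e: "0 < e"
  obtains A r where "0 \<le> A" "\<And>z. r \<le> Im z \<Longrightarrow> \<bar>Re z\<bar> \<le> 2 * Im z \<Longrightarrow>
    1 \<le> Im (of_real a * z + \<beta>) \<and> cmod (E (of_real a * z + \<beta>)) \<le> A * exp (e * Im z) * cmod (E z)"
proof -
  define W where "W = (\<lambda>z. of_real (sqrt (3 * S / 1)) * ((z + \<i> * of_real 1 - \<alpha>) * E (z + \<i> * of_real 1)))"
  have W1: "1 \<le> cmod (W z)" if "0 < Im z" for z unfolding W_def by (rule shifted_ge_one[OF _ that]) simp
  have hW: "W holomorphic_on upper_half_plane" unfolding W_def by (rule shifted_holomorphic)
  define X where "X = (\<lambda>z. ln (cmod (W z)) / Im z) ` upper_half_plane"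
  define c where "c = Inf X"
  \<comment> \<open>Harnack's inequality will contribute \<open>\<epsilon> (4 y)^2 / (a y / 2) = e y / 2\<close>; the other half
    of the exponent absorbs the factor \<open>z - \<alpha>\<close>.\<close>
  define \<epsilon> where "\<epsilon> = e * a / 64"
  have \<epsilon>: "0 < \<epsilon>" using e a by (simp add: \<epsilon>_def)
  have X0: "\<And>x. x \<in> X \<Longrightarrow> 0 \<le> x" using W1 by (auto simp: X_def)
  have Xne: "X \<noteq> {}" proof -
    have "\<i> \<in> upper_half_plane" by simp
    then show ?thesis unfolding X_def by blast
  qed
  have c0: "0 \<le> c" unfolding c_def by (rule cInf_greatest[OF Xne X0])
  have lower: "c * Im z \<le> ln (cmod (W z))" if "0 < Im z" for z
  proof -
    have "c \<le> ln (cmod (W z)) / Im z" unfolding c_def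
      by (rule cInf_lower) (use that X0 in \<open>auto simp: X_def intro!: bdd_belowI\<close>)
    then show ?thesis using that by (simp add: le_divide_eq)
  qed
  obtain x where "x \<in> X" "x < c + \<epsilon>" using cInf_lessD[OF Xne, of "c + \<epsilon>"] \<epsilon> by (auto simp: c_def)
  then obtain z0 where z0: "0 < Im z0" "ln (cmod (W z0)) / Im z0 < c + \<epsilon>" by (auto simp: X_def)
  have upper: "ln (cmod (W z)) \<le> c * Im z + \<epsilon> * (cmod (z - cnj z0))\<^sup>2 / Im z" if z: "0 < Im z" for z
  proof -
    define V where "V = (\<lambda>z. W z * exp (\<i> * of_real c * z))"
    have lnV: "ln (cmod (V z)) = ln (cmod (W z)) - c * Im z" if "0 < Im z" for z
    proof -
      have "W z \<noteq> 0" using W1[OF that] by auto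
      then show ?thesis by (simp add: V_def norm_mult ln_mult)
    qed
    have V1: "1 \<le> cmod (V z)" if "0 < Im z" for z
    proof -
      have "V z \<noteq> 0" using W1[OF that] by (auto simp: V_def)
      moreover have "0 \<le> ln (cmod (V z))" using lnV[OF that] lower[OF that] by simp
      ultimately show ?thesis by (simp add: ln_ge_zero_iff)
    qed
    have "ln (cmod (V z)) \<le> ln (cmod (V z0)) * (cmod (z - cnj z0))\<^sup>2 / (Im z * Im z0)"
      by (rule Harnack_log_modulus[OF _ V1 z0(1) z]) (auto simp: V_def intro!: holomorphic_intros hW)
    also have "\<dots> = (ln (cmod (V z0)) / Im z0) * ((cmod (z - cnj z0))\<^sup>2 / Im z)" by simp
    also have "\<dots> \<le> \<epsilon> * ((cmod (z - cnj z0))\<^sup>2 / Im z)"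
    proof (rule mult_right_mono)
      show "ln (cmod (V z0)) / Im z0 \<le> \<epsilon>"
        using z0 lnV[OF z0(1)] by (simp add: diff_divide_distrib)
    qed (use z in simp)
    finally show ?thesis using lnV[OF z] by simp
  qed
  define D where "D = cmod \<beta> + 1 + cmod z0"
  \<comment> \<open>Above this height the map \<open>a z + \<beta>\<close> stays at least at height \<open>1 + a y / 2\<close>, and all
    constants are dominated by \<open>y\<close>.\<close>
  define r where "r = 2 * D / a + D + cmod \<alpha> + 1"
  define A where "A = exp (c * cmod \<beta>) * (8 / (e * \<bar>Im \<alpha>\<bar>))"
  show ?thesis
  proof (rule that[of A r])
    show "0 \<le> A" using e by (simp add: A_def)
    fix z assume z: "r \<le> Im z" "\<bar>Re z\<bar> \<le> 2 * Im z"
    define y where "y = Im z"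
    define w where "w = of_real a * z + \<beta>"
    have D: "1 \<le> D" "cmod \<beta> + 1 \<le> D" by (simp_all add: D_def)
    have pos: "0 \<le> 2 * D / a" using D a by simp
    have y: "2 * D / a \<le> y" "D \<le> y" "cmod \<alpha> \<le> y" "1 < y"
      using z(1) pos D norm_ge_zero[of \<alpha>] unfolding r_def y_def by linarith+
    have ay: "D \<le> a * y / 2" using y(1) a by (simp add: field_simps)
    have Imw: "Im w = a * y + Im \<beta>" by (simp add: w_def y_def)
    have w1: "a * y / 2 \<le> Im w - 1" using ay D abs_Im_le_cmod[of \<beta>] unfolding Imw by linarith
    have w2: "0 < Im w - 1" using w1 ay D by linarith
    have cz: "cmod z \<le> 3 * y" using cmod_le[of z] z y unfolding y_def by linarith
    have "cmod (w - \<i> - cnj z0) \<le> cmod (of_real a * z) + (cmod \<beta> + 1 + cmod z0)"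
    proof -
      have "w - \<i> - cnj z0 = of_real a * z + (\<beta> - \<i> - cnj z0)" by (simp add: w_def)
      also have "cmod \<dots> \<le> cmod (of_real a * z) + cmod (\<beta> - \<i> - cnj z0)" by (rule norm_triangle_ineq)
      also have "cmod (\<beta> - \<i> - cnj z0) \<le> cmod (\<beta> - \<i>) + cmod (cnj z0)" by (rule norm_triangle_ineq4)
      also have "cmod (\<beta> - \<i>) \<le> cmod \<beta> + cmod \<i>" by (rule norm_triangle_ineq4)
      finally show ?thesis by simp
    qed
    also have "cmod (of_real a * z) \<le> 1 * cmod z" unfolding norm_mult using a by (intro mult_right_mono) auto
    finally have dist: "cmod (w - \<i> - cnj z0) \<le> 4 * y" using cz y(2) unfolding D_def by linarith
    have "ln (cmod (W (w - \<i>))) \<le> c * (Im w - 1) + \<epsilon> * ((cmod (w - \<i> - cnj z0))\<^sup>2 / (Im w - 1))"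
      using upper[of "w - \<i>"] w2 by simp
    also have "(cmod (w - \<i> - cnj z0))\<^sup>2 / (Im w - 1) \<le> (4 * y)\<^sup>2 / (a * y / 2)"
      using dist w1 w2 a y by (intro frac_le power_mono) auto
    also have "(4 * y)\<^sup>2 / (a * y / 2) = 32 * y / a" using a y by (simp add: power2_eq_square field_simps)
    also have "\<epsilon> * (32 * y / a) = e / 2 * y" using a by (simp add: \<epsilon>_def)
    finally have up: "ln (cmod (W (w - \<i>))) \<le> c * (Im w - 1) + e / 2 * y" using \<epsilon> by simp
    have lo: "c * (y - 1) \<le> ln (cmod (W (z - \<i>)))" using lower[of "z - \<i>"] y by (simp add: y_def)
    have "Im w - y \<le> cmod \<beta>"
    proof -
      have "a * y \<le> 1 * y" using a y by (intro mult_right_mono) auto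
      then show ?thesis using abs_Im_le_cmod[of \<beta>] unfolding Imw by linarith
    qed
    then have "c * (Im w - y) \<le> c * cmod \<beta>" by (rule mult_left_mono[OF _ c0])
    then have "ln (cmod (W (w - \<i>))) \<le> ln (cmod (W (z - \<i>))) + (c * cmod \<beta> + e / 2 * y)"
      using up lo by (simp add: algebra_simps)
    then have "exp (ln (cmod (W (w - \<i>)))) \<le> exp (ln (cmod (W (z - \<i>))) + (c * cmod \<beta> + e / 2 * y))" by simp
    moreover have "0 < cmod (W (w - \<i>))" "0 < cmod (W (z - \<i>))"
      using W1[of "w - \<i>"] W1[of "z - \<i>"] w2 y by (auto simp: y_def)
    ultimately have WW: "cmod (W (w - \<i>)) \<le> cmod (W (z - \<i>)) * exp (c * cmod \<beta> + e / 2 * y)"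
      by (simp only: exp_add exp_ln)
    have Wi: "cmod (W (u - \<i>)) = sqrt (3 * S) * (cmod (u - \<alpha>) * cmod (E u))" for u
      unfolding W_def norm_mult using S by simp
    have "0 < sqrt (3 * S)" using S by simp
    then have "cmod (w - \<alpha>) * cmod (E w) \<le> cmod (z - \<alpha>) * cmod (E z) * exp (c * cmod \<beta> + e / 2 * y)"
      using WW unfolding Wi by (simp add: mult.assoc)
    moreover have "\<bar>Im \<alpha>\<bar> * cmod (E w) \<le> cmod (w - \<alpha>) * cmod (E w)"
      using minus_\<alpha>(1)[of w] w2 by (intro mult_right_mono) auto
    moreover have "cmod (z - \<alpha>) * cmod (E z) * exp (c * cmod \<beta> + e / 2 * y)
        \<le> (8 / e * exp (e / 2 * y)) * cmod (E z) * exp (c * cmod \<beta> + e / 2 * y)"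
    proof (intro mult_right_mono)
      have "cmod (z - \<alpha>) \<le> 4 * y" using norm_triangle_ineq4[of z \<alpha>] cz y by linarith
      also have "\<dots> = 8 / e * (e / 2 * y)" using e by simp
      also have "\<dots> \<le> 8 / e * exp (e / 2 * y)"
      proof (rule mult_left_mono)
        show "e / 2 * y \<le> exp (e / 2 * y)" using exp_ge_add_one_self[of "e / 2 * y"] by linarith
      qed (use e in simp)
      finally show "cmod (z - \<alpha>) \<le> 8 / e * exp (e / 2 * y)" .
    qed auto
    ultimately have "\<bar>Im \<alpha>\<bar> * cmod (E w) \<le> (8 / e * exp (e / 2 * y)) * cmod (E z) * exp (c * cmod \<beta> + e / 2 * y)"
      by linarith
    also have "\<dots> = \<bar>Im \<alpha>\<bar> * (A * (exp (e / 2 * y) * exp (e / 2 * y)) * cmod (E z))"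
      unfolding A_def exp_add using \<alpha> by simp
    also have "exp (e / 2 * y) * exp (e / 2 * y) = exp (e * y)" by (simp add: exp_add[symmetric])
    finally have "cmod (E w) \<le> A * exp (e * y) * cmod (E z)" using \<alpha> by simp
    moreover have "1 \<le> Im w" using w2 by simp
    ultimately show "1 \<le> Im (of_real a * z + \<beta>) \<and>
        cmod (E (of_real a * z + \<beta>)) \<le> A * exp (e * Im z) * cmod (E z)"
      by (simp add: w_def y_def)
  qed
qed

text \<open>
  The square mean principle for \<open>k(a z + \<beta>) / E\<close>, factored into the entire function
  \<open>k(a z + \<beta>) (z - \<alpha>)\<close> of order at most two and the Hardy function
  \<open>1 / ((z - \<alpha>) E)\<close>.
\<close>

lemma composition_energy:
  assumes hol: "k holomorphic_on UNIV" and C: "0 \<le> C"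
    and up: "\<And>z. 0 < Im z \<Longrightarrow> cmod (k z) \<le> C * cmod (E z) / sqrt (Im z)"
    and down: "\<And>z. Im z < 0 \<Longrightarrow> cmod (k z) \<le> C * cmod (E (cnj z)) / sqrt (- Im z)"
    and a: "0 < a" "a \<le> 1"
    and bdry: "line_energy_le (\<lambda>z. k (of_real a * z + \<beta>) / E z) 0 N" and y: "0 < y"
  shows "line_energy_le (\<lambda>z. k (of_real a * z + \<beta>) / E z) y N"
proof -
  obtain K where K: "0 < K" "\<And>z. cmod (k z) \<le> exp (K * (1 + cmod z)\<^sup>2)"
    by (rule entire_growth[OF hol C up down]) blast+
  define C' where "C' = K * (1 + cmod \<beta>)\<^sup>2 + (1 + cmod \<alpha>)"
  have "(k \<circ> (\<lambda>z. of_real a * z + \<beta>)) holomorphic_on UNIV"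
    by (rule holomorphic_on_compose_gen[OF _ hol]) (auto intro!: holomorphic_intros)
  then have hk: "(\<lambda>z. k (of_real a * z + \<beta>)) holomorphic_on A" for A
    unfolding o_def by (rule holomorphic_on_subset) simp
  note ck = holomorphic_on_imp_continuous_on[OF hk]
  show ?thesis
  proof (rule L2_Phragmen_Lindelof[where P = "\<lambda>z. k (of_real a * z + \<beta>) * (z - \<alpha>)"
        and Q = "\<lambda>z. 1 / ((z - \<alpha>) * E z)" and C = C' and S = S])
    show "continuous_on {z. 0 \<le> Im z} (\<lambda>z. k (of_real a * z + \<beta>) / E z)"
      by (intro continuous_intros ck cont_E) (use nonzero_closed in auto)
    show "(\<lambda>z. k (of_real a * z + \<beta>) / E z) holomorphic_on {z. 0 < Im z}"
      by (intro holomorphic_intros hk) (use nonzero in auto)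
    show "continuous_on {z. 0 < Im z} (\<lambda>z. k (of_real a * z + \<beta>) * (z - \<alpha>))"
      by (intro continuous_intros ck)
    show "continuous_on {z. 0 < Im z} (\<lambda>z. 1 / ((z - \<alpha>) * E z))"
      by (intro continuous_intros cont_E) (use nonzero minus_\<alpha> in \<open>auto simp: less_imp_le\<close>)
    show "k (of_real a * z + \<beta>) / E z = k (of_real a * z + \<beta>) * (z - \<alpha>) * (1 / ((z - \<alpha>) * E z))"
      if "0 < Im z" for z
      using minus_\<alpha>(2)[of z] that by simp
    show "0 \<le> C'" using K by (simp add: C'_def)
    show "cmod (k (of_real a * z + \<beta>) * (z - \<alpha>)) \<le> exp (C' * (1 + cmod z)\<^sup>2)" for z
    proof -
      have "1 + cmod (of_real a * z + \<beta>) \<le> 1 + (cmod (of_real a * z) + cmod \<beta>)"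
        using norm_triangle_ineq[of "of_real a * z" \<beta>] by simp
      also have "\<dots> \<le> 1 + (1 * cmod z + cmod \<beta>)"
        unfolding norm_mult using a by (intro add_left_mono add_right_mono mult_right_mono) auto
      also have "\<dots> \<le> (1 + cmod \<beta>) * (1 + cmod z)" by (simp add: algebra_simps)
      finally have "(1 + cmod (of_real a * z + \<beta>))\<^sup>2 \<le> ((1 + cmod \<beta>) * (1 + cmod z))\<^sup>2"
        by (intro power_mono) auto
      then have "K * (1 + cmod (of_real a * z + \<beta>))\<^sup>2 \<le> K * ((1 + cmod \<beta>) * (1 + cmod z))\<^sup>2"
        using K by (intro mult_left_mono) auto
      then have "exp (K * (1 + cmod (of_real a * z + \<beta>))\<^sup>2) \<le> exp (K * ((1 + cmod \<beta>) * (1 + cmod z))\<^sup>2)" by simp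
      then have 1: "cmod (k (of_real a * z + \<beta>)) \<le> exp (K * ((1 + cmod \<beta>) * (1 + cmod z))\<^sup>2)"
        by (rule order_trans[OF K(2)])
      have one: "1 \<le> 1 + cmod z" by simp
      have "cmod (z - \<alpha>) \<le> cmod z + cmod \<alpha>" by (rule norm_triangle_ineq4)
      also have "\<dots> \<le> (1 + cmod \<alpha>) * (1 + cmod z)" by (simp add: algebra_simps)
      also have "\<dots> \<le> (1 + cmod \<alpha>) * (1 + cmod z)\<^sup>2"
        using one by (intro mult_left_mono self_le_power) auto
      also have "\<dots> \<le> exp ((1 + cmod \<alpha>) * (1 + cmod z)\<^sup>2)"
        using exp_ge_add_one_self[of "(1 + cmod \<alpha>) * (1 + cmod z)\<^sup>2"] by linarith
      finally have "cmod (k (of_real a * z + \<beta>)) * cmod (z - \<alpha>)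
          \<le> exp (K * ((1 + cmod \<beta>) * (1 + cmod z))\<^sup>2) * exp ((1 + cmod \<alpha>) * (1 + cmod z)\<^sup>2)"
        by (intro mult_mono 1) auto
      also have "\<dots> = exp (C' * (1 + cmod z)\<^sup>2)"
        unfolding C'_def exp_add[symmetric] power_mult_distrib by (simp add: algebra_simps)
      finally show ?thesis by (simp only: norm_mult)
    qed
    show "\<exists>A r. \<forall>z. r \<le> Im z \<and> \<bar>Re z\<bar> \<le> 2 * Im z \<longrightarrow>
        cmod (k (of_real a * z + \<beta>) / E z) \<le> A * exp (e * Im z)" if e: "0 < e" for e
    proof -
      obtain A r where A: "0 \<le> A" and Ar: "\<And>z. r \<le> Im z \<Longrightarrow> \<bar>Re z\<bar> \<le> 2 * Im z \<Longrightarrow>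
          1 \<le> Im (of_real a * z + \<beta>) \<and> cmod (E (of_real a * z + \<beta>)) \<le> A * exp (e * Im z) * cmod (E z)"
        by (rule E_ratio_bound[OF a e]) blast
      have "cmod (k (of_real a * z + \<beta>) / E z) \<le> C * A * exp (e * Im z)"
        if z: "max r 1 \<le> Im z" "\<bar>Re z\<bar> \<le> 2 * Im z" for z
      proof -
        let ?w = "of_real a * z + \<beta>"
        have w: "1 \<le> Im ?w" "cmod (E ?w) \<le> A * exp (e * Im z) * cmod (E z)" using Ar[of z] z by auto
        have Ez: "0 < cmod (E z)" using nonzero[of z] z by simp
        have w0: "0 < Im ?w" using w(1) by linarith
        have "cmod (k ?w) \<le> C * cmod (E ?w) / sqrt (Im ?w)" by (rule up[OF w0])
        also have "\<dots> \<le> C * cmod (E ?w) / 1" by (rule divide_left_mono) (use w C in \<open>auto simp del: plus_complex.simps\<close>)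
        also have "\<dots> \<le> C * (A * exp (e * Im z) * cmod (E z))" using mult_left_mono[OF w(2) C] by simp
        finally show ?thesis using Ez by (simp add: norm_divide divide_le_eq mult.assoc)
      qed
      then show ?thesis by (intro exI[of _ "C * A"] exI[of _ "max r 1"]) blast
    qed
    show "0 \<le> N" by (rule line_energy_nonneg[OF bdry])
  qed (use S energy bdry y in auto)
qed

end

section \<open>Regularity and the norm of a de Branges space\<close>

text \<open>
  If \<open>g\<close> is the backward shift of \<open>f\<close> at \<open>\<alpha>\<close>, then
  \<open>f(\<alpha>) / ((z - \<alpha>) E) = (f / E) / (z - \<alpha>) - g / E\<close>, and the factor \<open>1 / (z - \<alpha>)\<close> is
  bounded on the upper half-plane when \<open>Im \<alpha> < 0\<close>. A nonzero entire function does not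
  vanish on the whole lower half-plane, which supplies \<open>\<alpha>\<close> with \<open>f(\<alpha>) \<noteq> 0\<close>.
\<close>

lemma regular_imp_reciprocal_hardy:
  assumes HB: "hermite_biehler E" and reg: "regular_dB E" and f: "f \<in> de_Branges E" and nz: "f z0 \<noteq> 0"
  shows "\<exists>\<alpha> S. reciprocal_hardy E \<alpha> S"
proof -
  have entE: "E holomorphic_on UNIV" using HB by (simp add: hermite_biehler_def)
  have nzE: "E z \<noteq> 0" if "0 < Im z" for z
    using HB that unfolding hermite_biehler_def by (metis norm_ge_zero not_le norm_zero upper_half_plane_props(3))
  have entf: "f holomorphic_on UNIV" using f by (simp add: de_Branges_def)
  obtain \<alpha> where \<alpha>: "Im \<alpha> < 0" "f \<alpha> \<noteq> 0"
  proof (rule ccontr)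
    assume "\<not> thesis"
    then have "f z = 0" if "z \<in> {z. Im z < 0}" for z using that \<open>\<And>\<alpha>. Im \<alpha> < 0 \<Longrightarrow> f \<alpha> \<noteq> 0 \<Longrightarrow> thesis\<close> by auto
    moreover have "{z. Im z < 0} \<noteq> {}" by (auto intro: exI[of _ "- \<i>"])
    ultimately have "f z0 = 0"
      by (intro analytic_continuation_open[of "{z. Im z < 0}" UNIV f "\<lambda>_. 0" z0])
        (use entf open_halfspace_Im_lt[of 0] in \<open>simp_all add: connected_UNIV\<close>)
    then show False using nz by simp
  qed
  define g where "g = backward_shift \<alpha> f"
  have g: "g \<in> de_Branges E" using reg f by (auto simp: regular_dB_def g_def)
  have "(\<lambda>z. f z / E z) \<in> hardy_H2" "(\<lambda>z. g z / E z) \<in> hardy_H2" using f g by (auto simp: de_Branges_def)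
  then obtain S1 S2 where S1: "0 < S1" "\<And>y. 0 < y \<Longrightarrow> line_energy_le (\<lambda>z. f z / E z) y S1"
    and S2: "0 < S2" "\<And>y. 0 < y \<Longrightarrow> line_energy_le (\<lambda>z. g z / E z) y S2"
    unfolding hardy_H2_iff by blast
  have contE: "continuous_on A E" and contf: "continuous_on A f" and contg: "continuous_on A g" for A
    using entE entf g by (auto simp: de_Branges_def intro!: holomorphic_on_imp_continuous_on intro: holomorphic_on_subset)
  define p where "p = 2 / ((cmod (f \<alpha>))\<^sup>2 * (Im \<alpha>)\<^sup>2)"
  define q where "q = 2 / (cmod (f \<alpha>))\<^sup>2"
  have pq: "0 < p" "0 < q" using \<alpha> by (auto simp: p_def q_def)
  define S where "S = p * S1 + q * S2"
  have "line_energy_le (\<lambda>z. 1 / ((z - \<alpha>) * E z)) y S" if y: "0 < y" for y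
    unfolding line_energy_le_def
  proof (intro allI impI)
    fix L :: real assume L: "0 < L"
    let ?u = "\<lambda>x. (cmod (f (Complex x y) / E (Complex x y)))\<^sup>2"
    let ?v = "\<lambda>x. (cmod (g (Complex x y) / E (Complex x y)))\<^sup>2"
    have nzx: "E (Complex x y) \<noteq> 0" "Complex x y - \<alpha> \<noteq> 0" for x
      using nzE[of "Complex x y"] y \<alpha> by (auto simp: complex_eq_iff)
    have cl: "continuous_on A (\<lambda>x. h (Complex x y))" if "\<And>A. continuous_on A h" for A and h :: "complex \<Rightarrow> complex"
      by (rule continuous_on_horizontal_line[OF that[of UNIV]]) simp
    have cC: "continuous_on A (\<lambda>x. Complex x y)" for A unfolding Complex_eq by (intro continuous_intros)
    have iu: "?u integrable_on {-L..L}" "?v integrable_on {-L..L}"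
      by (auto intro!: integrable_continuous_interval continuous_intros cl[OF contE] cl[OF contf] cl[OF contg] nzx)
    have "integral {-L..L} (\<lambda>x. (cmod (1 / ((Complex x y - \<alpha>) * E (Complex x y))))\<^sup>2)
        \<le> integral {-L..L} (\<lambda>x. p * ?u x + q * ?v x)"
    proof (rule integral_le)
      fix x assume "x \<in> {-L..L}"
      let ?z = "Complex x y"
      define A where "A = f ?z / E ?z"
      define B where "B = g ?z / E ?z"
      have "g ?z = (f ?z - f \<alpha>) / (?z - \<alpha>)" using nzx[of x] by (simp add: g_def backward_shift_def)
      then have "f \<alpha> * (1 / ((?z - \<alpha>) * E ?z)) = A / (?z - \<alpha>) - B"
      proof -
        have "f \<alpha> = f ?z - (?z - \<alpha>) * g ?z" using \<open>g ?z = _\<close> nzx[of x] by simp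
        then have "f \<alpha> * (1 / ((?z - \<alpha>) * E ?z)) = (f ?z - (?z - \<alpha>) * g ?z) / ((?z - \<alpha>) * E ?z)" by simp
        also have "\<dots> = f ?z / ((?z - \<alpha>) * E ?z) - ((?z - \<alpha>) * g ?z) / ((?z - \<alpha>) * E ?z)"
          by (rule diff_divide_distrib)
        also have "((?z - \<alpha>) * g ?z) / ((?z - \<alpha>) * E ?z) = g ?z / E ?z"
          using nzx[of x] by (intro mult_divide_mult_cancel_left) simp
        also have "f ?z / ((?z - \<alpha>) * E ?z) = f ?z / E ?z / (?z - \<alpha>)"
          by (simp only: divide_divide_eq_left mult.commute)
        finally show ?thesis by (simp only: A_def B_def)
      qed
      then have "cmod (f \<alpha>) * cmod (1 / ((?z - \<alpha>) * E ?z)) \<le> cmod A / cmod (?z - \<alpha>) + cmod B"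
        using norm_triangle_ineq4[of "A / (?z - \<alpha>)" B] by (simp only: norm_mult[symmetric] norm_divide[symmetric])
      also have "cmod A / cmod (?z - \<alpha>) \<le> cmod A / \<bar>Im \<alpha>\<bar>"
        using abs_Im_le_cmod[of "?z - \<alpha>"] \<alpha> y nzx[of x] by (intro divide_left_mono mult_pos_pos) auto
      finally have "(cmod (f \<alpha>) * cmod (1 / ((?z - \<alpha>) * E ?z)))\<^sup>2 \<le> (cmod A / \<bar>Im \<alpha>\<bar> + cmod B)\<^sup>2"
        by (intro power_mono) auto
      also have "\<dots> \<le> 2 * (cmod A / \<bar>Im \<alpha>\<bar>)\<^sup>2 + 2 * (cmod B)\<^sup>2"
        using sum_squares_bound[of "cmod A / \<bar>Im \<alpha>\<bar>" "cmod B"] by (simp add: power2_sum)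
      finally have "(cmod (f \<alpha>))\<^sup>2 * (cmod (1 / ((?z - \<alpha>) * E ?z)))\<^sup>2 \<le> 2 / (Im \<alpha>)\<^sup>2 * (cmod A)\<^sup>2 + 2 * (cmod B)\<^sup>2"
        by (simp only: power_mult_distrib power_divide power2_abs) simp
      then have "(cmod (1 / ((?z - \<alpha>) * E ?z)))\<^sup>2 \<le> (2 / (Im \<alpha>)\<^sup>2 * (cmod A)\<^sup>2 + 2 * (cmod B)\<^sup>2) / (cmod (f \<alpha>))\<^sup>2"
        using \<alpha> by (simp add: le_divide_eq mult.commute)
      also have "\<dots> = p * (cmod A)\<^sup>2 + q * (cmod B)\<^sup>2" by (simp add: p_def q_def add_divide_distrib)
      finally show "(cmod (1 / ((?z - \<alpha>) * E ?z)))\<^sup>2 \<le> p * (cmod (f ?z / E ?z))\<^sup>2 + q * (cmod (g ?z / E ?z))\<^sup>2"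
        by (simp only: A_def B_def)
    qed (use nzx in \<open>auto intro!: integrable_continuous_interval continuous_intros cC cl[OF contE] cl[OF contf] cl[OF contg]\<close>)
    also have "\<dots> = p * integral {-L..L} ?u + q * integral {-L..L} ?v"
      using iu by (subst integral_add) (auto intro!: integrable_on_mult_right)
    also have "\<dots> \<le> p * S1 + q * S2"
      using S1(2)[OF y] S2(2)[OF y] L pq unfolding line_energy_le_def by (intro add_mono mult_left_mono) auto
    finally show "integral {-L..L} (\<lambda>x. (cmod (1 / ((Complex x y - \<alpha>) * E (Complex x y))))\<^sup>2) \<le> S"
      by (simp only: S_def)
  qed
  moreover have "0 < S" using pq S1 S2 by (simp add: S_def add_pos_pos)
  ultimately have "reciprocal_hardy E \<alpha> S" using entE nzE \<alpha> by unfold_locales auto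
  then show ?thesis by blast
qed

lemma dB_norm_eq:
  assumes "continuous_on UNIV (\<lambda>x. f (Complex x 0) / E (Complex x 0))"
  shows "dB_norm E f = sqrt (enn2real (\<integral>\<^sup>+x. ennreal ((cmod (f (Complex x 0) / E (Complex x 0)))\<^sup>2) \<partial>lborel))"
proof -
  let ?h = "\<lambda>x. (cmod (f (Complex x 0) / E (Complex x 0)))\<^sup>2"
  have "dB_inner E f f = (LINT x|lborel. complex_of_real (?h x))"
    unfolding dB_inner_def
    by (intro Bochner_Integration.integral_cong) (simp_all add: complex_norm_square[symmetric] norm_divide power_divide complex_of_real_def[symmetric] del: of_real_power)
  also have "\<dots> = of_real (LINT x|lborel. ?h x)" by (rule integral_complex_of_real)
  also have "(LINT x|lborel. ?h x) = enn2real (\<integral>\<^sup>+x. ennreal (?h x) \<partial>lborel)"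
    by (rule integral_eq_nn_integral) (use assms in \<open>auto intro!: borel_measurable_continuous_onI continuous_intros\<close>)
  finally show ?thesis by (simp add: dB_norm_def)
qed

lemma dB_norm_le_sqrt_energy:
  assumes "continuous_on UNIV (\<lambda>x. f (Complex x 0) / E (Complex x 0))"
    and "line_energy_le (\<lambda>z. f z / E z) 0 N"
  shows "dB_norm E f \<le> sqrt N"
proof -
  have "(\<integral>\<^sup>+x. ennreal ((cmod (f (Complex x 0) / E (Complex x 0)))\<^sup>2) \<partial>lborel) \<le> ennreal N"
    using assms line_energy_nonneg[OF assms(2)] line_energy_le_iff_nn_integral[of "\<lambda>z. f z / E z" 0 N] by simp
  then show ?thesis unfolding dB_norm_eq[OF assms(1)]
    by (simp add: enn2real_leI line_energy_nonneg[OF assms(2)])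
qed

text \<open>
  The hypothesis of finite energy matters: the norm of a function with infinite energy would be
  \<open>0\<close>, the value of an integral that does not exist.
\<close>

lemma energy_le_dB_norm:
  assumes c: "continuous_on UNIV (\<lambda>x. f (Complex x 0) / E (Complex x 0))"
    and "line_energy_le (\<lambda>z. f z / E z) 0 N"
  shows "line_energy_le (\<lambda>z. f z / E z) 0 ((dB_norm E f)\<^sup>2)"
proof -
  let ?I = "\<integral>\<^sup>+x. ennreal ((cmod (f (Complex x 0) / E (Complex x 0)))\<^sup>2) \<partial>lborel"
  have "?I \<le> ennreal N"
    using assms line_energy_nonneg[OF assms(2)] line_energy_le_iff_nn_integral[of "\<lambda>z. f z / E z" 0 N] by simp
  then have "?I < \<infinity>" by (simp add: le_less_trans)
  then have "?I \<le> ennreal ((dB_norm E f)\<^sup>2)" unfolding dB_norm_eq[OF c] by simp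
  then show ?thesis using c line_energy_le_iff_nn_integral[of "\<lambda>z. f z / E z" 0 "(dB_norm E f)\<^sup>2"] by simp
qed

lemma sharp_entire:
  assumes "f holomorphic_on UNIV" shows "sharp f holomorphic_on UNIV"
proof -
  have "(cnj \<circ> f \<circ> cnj) holomorphic_on UNIV"
    by (rule holomorphic_on_compose_cnj_cnj) (auto intro: holomorphic_on_subset[OF assms])
  then show ?thesis by (simp add: sharp_def o_def)
qed

section \<open>Composition with affine maps on a de Branges space\<close>

context reciprocal_hardy
begin

lemma hardy_quotient_bound:
  assumes "(\<lambda>z. k z / E z) \<in> hardy_H2"
  obtains C where "0 \<le> C" "\<And>z. 0 < Im z \<Longrightarrow> cmod (k z) \<le> C * cmod (E z) / sqrt (Im z)"
proof -
  obtain S' where S': "0 < S'" "\<And>y. 0 < y \<Longrightarrow> line_energy_le (\<lambda>z. k z / E z) y S'"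
    and hol: "(\<lambda>z. k z / E z) holomorphic_on upper_half_plane"
    using assms unfolding hardy_H2_iff by blast
  show ?thesis
  proof (rule that[of "sqrt (3 * S')"])
    fix z assume z: "0 < Im z"
    have "(cmod (k z / E z))\<^sup>2 \<le> 3 * S' / Im z" by (rule hardy_pointwise_bound[OF hol S' z])
    then have "cmod (k z / E z) \<le> sqrt (3 * S' / Im z)" by (rule real_le_rsqrt)
    then have "cmod (k z) / cmod (E z) \<le> sqrt (3 * S') / sqrt (Im z)" by (simp add: norm_divide real_sqrt_divide)
    then show "cmod (k z) \<le> sqrt (3 * S') * cmod (E z) / sqrt (Im z)"
      using nonzero[OF z] by (simp add: divide_le_eq)
  qed (use S' in simp)
qed

lemma de_Branges_bounds:
  assumes f: "f \<in> de_Branges E"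
  obtains C where "0 \<le> C"
    "\<And>z. 0 < Im z \<Longrightarrow> cmod (f z) \<le> C * cmod (E z) / sqrt (Im z)"
    "\<And>z. 0 < Im z \<Longrightarrow> cmod (sharp f z) \<le> C * cmod (E z) / sqrt (Im z)"
proof -
  obtain C1 where C1: "0 \<le> C1" "\<And>z. 0 < Im z \<Longrightarrow> cmod (f z) \<le> C1 * cmod (E z) / sqrt (Im z)"
    using f by (auto simp: de_Branges_def elim: hardy_quotient_bound)
  obtain C2 where C2: "0 \<le> C2" "\<And>z. 0 < Im z \<Longrightarrow> cmod (sharp f z) \<le> C2 * cmod (E z) / sqrt (Im z)"
    using f by (auto simp: de_Branges_def elim: hardy_quotient_bound)
  have mono: "C * cmod (E z) / sqrt (Im z) \<le> max C1 C2 * cmod (E z) / sqrt (Im z)"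
    if "C \<le> max C1 C2" "0 < Im z" for C z
    using that by (intro divide_right_mono mult_right_mono) auto
  show ?thesis
  proof (rule that[of "max C1 C2"])
    show "cmod (f z) \<le> max C1 C2 * cmod (E z) / sqrt (Im z)" if "0 < Im z" for z
      by (rule order_trans[OF C1(2)[OF that] mono]) (use that in auto)
    show "cmod (sharp f z) \<le> max C1 C2 * cmod (E z) / sqrt (Im z)" if "0 < Im z" for z
      by (rule order_trans[OF C2(2)[OF that] mono]) (use that in auto)
  qed (use C1 in auto)
qed

lemma quotient_continuous_on_line:
  assumes "continuous_on UNIV k"
  shows "0 \<le> y \<Longrightarrow> continuous_on UNIV (\<lambda>x. k (Complex x y) / E (Complex x y))"
  by (rule continuous_on_horizontal_line[where F = "\<lambda>z. k z / E z" and A = "{z. 0 \<le> Im z}"])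
    (use nonzero_closed in \<open>auto intro!: continuous_intros continuous_on_subset[OF assms] cont_E\<close>)

text \<open>
  The norm, an integral over the real line, dominates the square means on all higher lines. This
  is the case of the identity map among the compositions; the boundary value at height
  \<open>0\<close> is finite by continuity up to the line.
\<close>

lemma de_Branges_line_energy:
  assumes f: "f \<in> de_Branges E" and y: "0 \<le> y"
  shows "line_energy_le (\<lambda>z. f z / E z) y ((dB_norm E f)\<^sup>2)"
proof -
  have hol: "f holomorphic_on UNIV" using f by (simp add: de_Branges_def)
  note cont = holomorphic_on_imp_continuous_on[OF hol]
  obtain S' where S': "\<And>y. 0 < y \<Longrightarrow> line_energy_le (\<lambda>z. f z / E z) y S'"
    using f by (auto simp: de_Branges_def hardy_H2_iff)
  have "line_energy_le (\<lambda>z. f z / E z) 0 S'"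
    by (rule line_energy_boundary[OF _ S'])
      (use nonzero_closed in \<open>auto intro!: continuous_intros continuous_on_subset[OF cont] cont_E\<close>)
  then have 0: "line_energy_le (\<lambda>z. f z / E z) 0 ((dB_norm E f)\<^sup>2)"
    by (intro energy_le_dB_norm quotient_continuous_on_line cont) auto
  obtain C where C: "0 \<le> C"
    "\<And>z. 0 < Im z \<Longrightarrow> cmod (f z) \<le> C * cmod (E z) / sqrt (Im z)"
    "\<And>z. 0 < Im z \<Longrightarrow> cmod (sharp f z) \<le> C * cmod (E z) / sqrt (Im z)"
    by (rule de_Branges_bounds[OF f]) blast
  show ?thesis
  proof (cases "y = 0")
    case False
    have "line_energy_le (\<lambda>z. f (of_real 1 * z + 0) / E z) y ((dB_norm E f)\<^sup>2)"
    proof (rule composition_energy[OF hol C(1,2)])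
      show "cmod (f z) \<le> C * cmod (E (cnj z)) / sqrt (- Im z)" if "Im z < 0" for z
        using C(3)[of "cnj z"] that by (simp add: sharp_def)
    qed (use 0 y False in auto)
    then show ?thesis by simp
  qed (use 0 in simp)
qed

text \<open>
  On the real line \<open>f(a t + b) / E(t)\<close> is \<open>E(a t + b) / E(t)\<close> times the restriction of
  \<open>f / E\<close> to the line at height \<open>Im b\<close>; the substitution \<open>s = Re b + a t\<close>
  contributes the factor \<open>1 / a\<close>.
\<close>

lemma composition_boundary_energy:
  assumes f: "f \<in> de_Branges E" and a: "0 < a" and b: "0 \<le> Im b" and M: "0 \<le> M"
    and bound: "AE t in lborel. cmod (E (of_real a * of_real t + b) / E (of_real t)) \<le> M"
  shows "line_energy_le (\<lambda>z. f (of_real a * z + b) / E z) 0 (M\<^sup>2 / a * (dB_norm E f)\<^sup>2)"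
proof -
  have hol: "f holomorphic_on UNIV" using f by (simp add: de_Branges_def)
  note cont = holomorphic_on_imp_continuous_on[OF hol]
  define G where "G = (\<lambda>s. ennreal ((cmod (f (Complex s (Im b)) / E (Complex s (Im b))))\<^sup>2))"
  define N where "N = (dB_norm E f)\<^sup>2"
  have cG: "continuous_on UNIV (\<lambda>s. f (Complex s (Im b)) / E (Complex s (Im b)))"
    by (rule quotient_continuous_on_line[OF cont b])
  have mG: "G \<in> borel_measurable borel" unfolding G_def
    by (intro measurable_compose[OF _ measurable_ennreal] borel_measurable_continuous_onI continuous_intros cG)
  have GN: "(\<integral>\<^sup>+s. G s \<partial>lborel) \<le> ennreal N"
    using de_Branges_line_energy[OF f b] line_energy_le_iff_nn_integral[of "\<lambda>z. f z / E z" "Im b" N] cG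
    by (simp add: G_def N_def)
  have "ennreal a * (\<integral>\<^sup>+t. G (Re b + a * t) \<partial>lborel) = (\<integral>\<^sup>+s. G s \<partial>lborel)"
    using nn_integral_real_affine[OF mG, of a "Re b"] a by simp
  then have aI: "ennreal a * (\<integral>\<^sup>+t. G (Re b + a * t) \<partial>lborel) \<le> ennreal N" using GN by simp
  have "(\<integral>\<^sup>+t. G (Re b + a * t) \<partial>lborel) = ennreal (1 / a) * (ennreal a * (\<integral>\<^sup>+t. G (Re b + a * t) \<partial>lborel))"
    using a by (simp add: mult.assoc[symmetric] ennreal_mult[symmetric])
  also have "\<dots> \<le> ennreal (1 / a) * ennreal N" by (rule mult_left_mono[OF aI]) simp
  also have "\<dots> = ennreal (N / a)" using a by (simp add: ennreal_mult[symmetric] N_def)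
  finally have I: "(\<integral>\<^sup>+t. G (Re b + a * t) \<partial>lborel) \<le> ennreal (N / a)" .
  have "(\<integral>\<^sup>+t. ennreal ((cmod (f (of_real a * Complex t 0 + b) / E (Complex t 0)))\<^sup>2) \<partial>lborel)
      \<le> (\<integral>\<^sup>+t. ennreal (M\<^sup>2) * G (Re b + a * t) \<partial>lborel)"
  proof (rule nn_integral_mono_AE, use bound in eventually_elim)
    fix t assume t: "cmod (E (of_real a * of_real t + b) / E (of_real t)) \<le> M"
    define w where "w = of_real a * of_real t + b"
    have w: "of_real a * of_real t + b = w" "Complex (Re b + a * t) (Im b) = w" "Complex t 0 = of_real t"
      by (simp_all add: w_def complex_eq_iff)
    have "E w \<noteq> 0" by (rule nonzero_closed) (use b in \<open>simp add: w_def\<close>)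
    then have "f w / E (of_real t) = (E w / E (of_real t)) * (f w / E w)" by simp
    then have "cmod (f w / E (of_real t)) \<le> M * cmod (f w / E w)"
      using t unfolding w_def[symmetric] by (simp only: norm_mult mult_right_mono norm_ge_zero)
    then have "(cmod (f w / E (of_real t)))\<^sup>2 \<le> M\<^sup>2 * (cmod (f w / E w))\<^sup>2"
      by (metis norm_ge_zero power_mono power_mult_distrib)
    then show "ennreal ((cmod (f (of_real a * Complex t 0 + b) / E (Complex t 0)))\<^sup>2) \<le> ennreal (M\<^sup>2) * G (Re b + a * t)"
      unfolding G_def w by (simp add: ennreal_mult[symmetric] ennreal_leI)
  qed
  also have "\<dots> = ennreal (M\<^sup>2) * (\<integral>\<^sup>+t. G (Re b + a * t) \<partial>lborel)"
    using mG by (intro nn_integral_cmult) simp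
  also have "\<dots> \<le> ennreal (M\<^sup>2) * ennreal (N / a)" by (rule mult_left_mono[OF I]) simp
  also have "\<dots> = ennreal (M\<^sup>2 / a * N)" using a by (simp add: ennreal_mult[symmetric] N_def)
  finally have le: "(\<integral>\<^sup>+t. ennreal ((cmod (f (of_real a * Complex t 0 + b) / E (Complex t 0)))\<^sup>2) \<partial>lborel)
      \<le> ennreal (M\<^sup>2 / a * N)" .
  have "continuous_on UNIV (\<lambda>x. f (of_real a * Complex x 0 + b) / E (Complex x 0))"
    by (rule quotient_continuous_on_line[where k = "\<lambda>z. f (of_real a * z + b)"])
      (auto intro!: continuous_intros continuous_on_compose2[OF cont])
  then show ?thesis using le a
    by (subst line_energy_le_iff_nn_integral) (auto simp: N_def)
qed

text \<open>
  The conjugate function of \<open>f(a z + b)\<close> is \<open>f\<^sup>#(a z + cnj b)\<close>. Its argument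
  leaves the upper half-plane when \<open>Im b > 0\<close>, so membership does not follow from that of
  \<open>f\<^sup>#\<close> by composing Hardy functions; the growth argument, however, works
  for every translation.
\<close>

lemma composition_in_de_Branges:
  assumes f: "f \<in> de_Branges E" and a: "0 < a" "a \<le> 1"
    and bdry: "line_energy_le (\<lambda>z. f (of_real a * z + b) / E z) 0 N"
  shows "(\<lambda>z. f (of_real a * z + b)) \<in> de_Branges E"
proof -
  have hol: "f holomorphic_on UNIV" using f by (simp add: de_Branges_def)
  have affine: "(\<lambda>z. k (of_real a * z + \<beta>)) holomorphic_on A" if "k holomorphic_on UNIV" for k A \<beta>
  proof -
    have "(k \<circ> (\<lambda>z. of_real a * z + \<beta>)) holomorphic_on A"
      by (rule holomorphic_on_compose_gen[OF _ that]) (auto intro!: holomorphic_intros)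
    then show ?thesis by (simp only: o_def)
  qed
  obtain C where C: "0 \<le> C"
    "\<And>z. 0 < Im z \<Longrightarrow> cmod (f z) \<le> C * cmod (E z) / sqrt (Im z)"
    "\<And>z. 0 < Im z \<Longrightarrow> cmod (sharp f z) \<le> C * cmod (E z) / sqrt (Im z)"
    by (rule de_Branges_bounds[OF f]) blast
  have hardy: "(\<lambda>z. k (of_real a * z + \<beta>) / E z) \<in> hardy_H2"
    if k: "k holomorphic_on UNIV" and kb: "line_energy_le (\<lambda>z. k (of_real a * z + \<beta>) / E z) 0 N"
      and up: "\<And>z. 0 < Im z \<Longrightarrow> cmod (k z) \<le> C * cmod (E z) / sqrt (Im z)"
      and down: "\<And>z. 0 < Im z \<Longrightarrow> cmod (sharp k z) \<le> C * cmod (E z) / sqrt (Im z)" for k \<beta>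
    unfolding hardy_H2_iff
  proof (intro conjI exI allI impI)
    show "(\<lambda>z. k (of_real a * z + \<beta>) / E z) holomorphic_on upper_half_plane"
      by (intro holomorphic_intros affine k) (use nonzero in auto)
    show "0 < N + 1" using line_energy_nonneg[OF bdry] by simp
    fix y :: real assume y: "0 < y"
    have "line_energy_le (\<lambda>z. k (of_real a * z + \<beta>) / E z) y N"
    proof (rule composition_energy[OF k C(1) up _ a kb y])
      show "cmod (k z) \<le> C * cmod (E (cnj z)) / sqrt (- Im z)" if "Im z < 0" for z
        using down[of "cnj z"] that by (simp add: sharp_def)
    qed
    then show "line_energy_le (\<lambda>z. k (of_real a * z + \<beta>) / E z) y (N + 1)"
      by (rule line_energy_mono) simp
  qed
  have sharp_comp: "sharp (\<lambda>z. f (of_real a * z + b)) = (\<lambda>z. sharp f (of_real a * z + cnj b))"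
    by (simp add: sharp_def)
  have "line_energy_le (\<lambda>z. sharp f (of_real a * z + cnj b) / E z) 0 N"
  proof -
    have "cmod (sharp f (of_real a * Complex x 0 + cnj b) / E (Complex x 0))
        = cmod (f (of_real a * Complex x 0 + b) / E (Complex x 0))" for x
    proof -
      have "cnj (of_real a * Complex x 0 + cnj b) = of_real a * Complex x 0 + b" by (simp add: complex_eq_iff)
      then show ?thesis unfolding sharp_def norm_divide by (simp only: complex_mod_cnj)
    qed
    then show ?thesis using bdry unfolding line_energy_le_def by simp
  qed
  then have "(\<lambda>z. sharp f (of_real a * z + cnj b) / E z) \<in> hardy_H2"
    using C by (intro hardy sharp_entire hol) (auto simp: sharp_def)
  moreover have "(\<lambda>z. f (of_real a * z + b) / E z) \<in> hardy_H2"
    using C by (intro hardy hol bdry) auto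
  ultimately show ?thesis
    unfolding de_Branges_def mem_Collect_eq sharp_comp using affine[OF hol] by blast
qed

end

theorem theorem5p4:
  fixes E :: "complex \<Rightarrow> complex" and a b\<^sub>1 b\<^sub>2 :: real and b :: complex
    and \<phi> :: "complex \<Rightarrow> complex"
  assumes "hermite_biehler E"
    and "regular_dB E"
    and "0 < a" and "a \<le> 1"
    and "b = of_real b\<^sub>1 + \<i> * of_real b\<^sub>2" and "b\<^sub>2 \<ge> 0"
    and "\<And>z. \<phi> z = of_real a * z + b"
    and "ess_bounded (\<lambda>t. E (of_real a * of_real t + b) / E (of_real t))"
  shows "bounded_operator_dB E (comp_op \<phi>)"
proof -
  have comp: "comp_op \<phi> f = (\<lambda>z. f (of_real a * z + b))" for f
    by (simp add: comp_op_def o_def assms(7))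
  have Imb: "0 \<le> Im b" using assms(5,6) by simp
  have "(\<forall>f\<in>de_Branges E. comp_op \<phi> f \<in> de_Branges E) \<and>
    (\<exists>C. \<forall>f\<in>de_Branges E. dB_norm E (comp_op \<phi> f) \<le> C * dB_norm E f)"
  proof (cases "\<exists>f\<in>de_Branges E. \<exists>z. f z \<noteq> 0")
    case False
    then have "comp_op \<phi> f = f" if "f \<in> de_Branges E" for f
      using that by (auto simp: comp fun_eq_iff)
    then show ?thesis by (auto intro!: exI[of _ 1])
  next
    case True
    then obtain \<alpha> S where "reciprocal_hardy E \<alpha> S"
      using regular_imp_reciprocal_hardy[OF assms(1,2)] by blast
    then interpret reciprocal_hardy E \<alpha> S .
    obtain M0 where "AE t in lborel. cmod (E (of_real a * of_real t + b) / E (of_real t)) \<le> M0"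
      using assms(8) by (auto simp: ess_bounded_def)
    then have M: "AE t in lborel. cmod (E (of_real a * of_real t + b) / E (of_real t)) \<le> \<bar>M0\<bar>"
      by eventually_elim linarith
    define N where "N = (\<lambda>f. M0\<^sup>2 / a * (dB_norm E f)\<^sup>2)"
    have bdry: "line_energy_le (\<lambda>z. f (of_real a * z + b) / E z) 0 (N f)" if "f \<in> de_Branges E" for f
      using composition_boundary_energy[OF that assms(3) Imb _ M] by (simp add: N_def)
    have mem: "comp_op \<phi> f \<in> de_Branges E" if "f \<in> de_Branges E" for f
      unfolding comp by (rule composition_in_de_Branges[OF that assms(3,4) bdry[OF that]])
    have "dB_norm E (comp_op \<phi> f) \<le> \<bar>M0\<bar> / sqrt a * dB_norm E f" if f: "f \<in> de_Branges E" for f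
    proof -
      have "continuous_on UNIV (comp_op \<phi> f)"
        using mem[OF f] by (simp add: de_Branges_def holomorphic_on_imp_continuous_on)
      then have "dB_norm E (comp_op \<phi> f) \<le> sqrt (N f)"
        using bdry[OF f] by (intro dB_norm_le_sqrt_energy quotient_continuous_on_line) (auto simp: comp)
      also have "\<dots> = \<bar>M0\<bar> / sqrt a * \<bar>dB_norm E f\<bar>"
        by (simp add: N_def real_sqrt_mult real_sqrt_divide)
      also have "\<bar>dB_norm E f\<bar> = dB_norm E f"
        using dB_norm_eq[OF quotient_continuous_on_line[of f 0]] f
        by (simp add: de_Branges_def holomorphic_on_imp_continuous_on)
      finally show ?thesis .
    qed
    then show ?thesis using mem by blast
  qed
  then show ?thesis by (auto simp: bounded_operator_dB_def comp)
qed

end
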